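(* Let $\alpha,q\in(-1,1)$ and $n\ge 1$. For $i=1,\dots,2n$ let $x_{\bar i},x_i\in H_{\mathbb R}$. Then $$\varphi\big(G_{\alpha,q}(x_{\overline{2n}}\otimes x_{2n})\,G_{\alpha,q}(x_{\overline{2n-1}}\otimes x_{2n-1})\cdots G_{\alpha,q}(x_{\bar 1}\otimes x_1)\big)=\sum_{\pi\in\mathcal P^B_2(2n)}\alpha^{\mathrm{Nb}(\pi)}\,q^{\mathrm{Cr}(\pi)}\prod_{(i,j)\in \mathrm{Pair}(\pi)}\langle x_i,x_j\rangle ,$$ where $\varphi$ is the vacuum state, $G_{\alpha,q}$ is the double Gaussian operator of type B, and the product runs over all two-element blocks $(i,j)$, $i<j$, of $\pi$ (a block and its reflection both contribute a factor).
   Context: Notation: $\bar k=-k$, $[\pm n]=\{-n,\dots,-1,1,\dots,n\}$; $0^0=1$. Double Fock space of type B. $H_{\mathbb R}$ is a separable real Hilbert space, $H$ its complexification, with inner product $\langle\cdot,\cdot\rangle$ linear in the right argument. Put $\mathcal K_n=H^{\otimes 2n}$, with tensor factors indexed by $[\pm n]$ in increasing order: $x_{\bar n}\otimes\cdots\otimes x_{\bar 1}\otimes x_1\otimes\cdots\otimes x_n$; $\mathcal K_0=\mathbb C\,\Omega\otimes\Omega$ with $\Omega\otimes\Omega$ a unit vector. Let $\mathcal F_{\rm fin}=\bigoplus_{n\ge 0}\mathcal K_n$ (algebraic direct sum) with $\langle x_{\bar n}\otimes\cdots\otimes x_n,\,y_{\bar m}\otimes\cdots\otimes y_m\rangle_{0,0}=\delta_{m,n}\prod_{i\in[\pm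 n]}\langle x_i,y_i\rangle$. The hyperoctahedral group $B(n)$ is the group of permutations $\sigma$ of $[\pm n]$ with $\sigma(-i)=-\sigma(i)$; it is a Coxeter group with generators $\pi_0=(\bar 1\ 1)$ and $\pi_i=(i\ \, i{+}1)(\bar i\ \,\overline{i+1})$, $1\le i\le n-1$. It acts on $\mathcal K_n$ by $\sigma(x_{\bar n}\otimes\cdots\otimes x_n)=x_{\sigma^{-1}(\bar n)}\otimes\cdots\otimes x_{\sigma^{-1}(n)}$. For $\sigma\in B(n)$, $l_1(\sigma)$ (resp. $l_2(\sigma)$) is the number of occurrences of $\pi_0$ (resp. of all of $\pi_1,\dots,\pi_{n-1}$) in a minimal-length expression of $\sigma$ in the generators (this is independent of the expression). Put $P^{(n)}_{\alpha,q}=\sum_{\sigma\in B(n)}\alpha^{l_1(\sigma)}q^{l_2(\sigma)}\sigma$ on $\mathcal K_n$ and $P^{(0)}_{\alpha,q}=I$; for $\alpha,q\in(-1,1)$ these operators are strictly positive. The deformed inner product on $\mathcal F_{\rm fin}$ is $\langle f,g\rangle_{\alpha,q}=\delta_{m,n}\langle f,P^{(m)}_{\alpha,q}g\rangle_{0,0}$ for $f\in\mathcal K_n$, $g\in\mathcal K_m$. Operators. For $x,y\in H$, $b^*_{\alpha,q}(x\otimes y)(x_{\bar n}\otimes\cdots\otimes x_n)=x\otimes x_{\bar n}\otimes\cdots\otimes x_n\otimes y$ and $b^*_{\alpha,q}(x\otimes y)(\Omega\otimes\Omega)=x\otimes y$. The operator $b_{\alpha,q}(x\otimes y)$ is the adjoint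 of $b^*_{\alpha,q}(x\otimes y)$ with respect to $\langle\cdot,\cdot\rangle_{\alpha,q}$ (it maps $\mathcal F_{\rm fin}$ to itself and annihilates $\Omega\otimes\Omega$). For $x,y\in H_{\mathbb R}$, $G_{\alpha,q}(x\otimes y)=b_{\alpha,q}(x\otimes y)+b^*_{\alpha,q}(x\otimes y)$. The vacuum state is $\varphi(A)=\langle\Omega\otimes\Omega,A(\Omega\otimes\Omega)\rangle_{\alpha,q}$. Pair partitions of type B. For a pair $V=(a,b)$, $a<b$, its reflection is $\overline V=(\bar b,\bar a)$. $\mathcal P^B_2(n)$ is the set of partitions $\pi$ of $[\pm n]$ into two-element blocks such that $\overline V\in\pi$ for all $V\in\pi$ and $\overline V\neq V$ for all $V\in\pi$. $\mathrm{Pair}(\pi)$ is the set of all blocks of $\pi$. A B-pair of $\pi$ is $(\overline V,V)=((\bar b,\bar a),(a,b))$ with $(\bar b,\bar a),(a,b)\in\pi$, $b>0$ and $|a|<b$; it is positive if $ab>0$ and negative otherwise. $\mathrm{Pair}_B(\pi)$ is the set of B-pairs of $\pi$. $\mathrm{Nb}(\pi)$ is the number of negative B-pairs. For pairs $V=(i,j)$, $W=(k,l)$, write $V\overset{cr}{\sim}W$ if $i<k<j<l$. The number of crossings $\mathrm{Cr}(\pi)$ is the sum of (i) the number of unordered pairs of distinct B-pairs $\{(\overline V,V),(\overline W,W)\}$ with $V\overset{cr}{\sim}W$ or $W\overset{cr}{\sim}V$, and (ii) the number of unordered pairs of distinct B-pairs $\{(\overline V,V),(\overline W,W)\}$ with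 $\overline V\overset{cr}{\sim}W$ (this condition is symmetric in the two B-pairs). *)

theory Defs
  imports
    "HOL-Analysis.Analysis"
    "HOL-Combinatorics.Permutations"
    "HOL-Library.Disjoint_Sets"
    "HOL-Library.Function_Algebras"
begin

section \<open>The complexification of a real Hilbert space\<close>

text \<open>The pair \<open>(a, b)\<close> stands for \<open>a + ib\<close>. A separable real Hilbert space is a type of sort
  \<open>{real_inner, polish_space}\<close> (complete and second countable).\<close>

type_synonym 'a cplx = "'a \<times> 'a"

definition cplx_scale :: "complex \<Rightarrow> 'a::real_vector cplx \<Rightarrow> 'a cplx" where
  "cplx_scale c x = (Re c *\<^sub>R fst x - Im c *\<^sub>R snd x, Re c *\<^sub>R snd x + Im c *\<^sub>R fst x)"

definition cplx_of :: "'a::real_vector \<Rightarrow> 'a cplx" where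
  "cplx_of a = (a, 0)"

text \<open>The inner product is conjugate linear on the left and linear on the right.\<close>

definition cinner :: "'a::real_inner cplx \<Rightarrow> 'a cplx \<Rightarrow> complex" where
  "cinner x y = Complex (fst x \<bullet> fst y + snd x \<bullet> snd y) (fst x \<bullet> snd y - snd x \<bullet> fst y)"

lemma cinner_commute: "cinner y x = cnj (cinner x y)"
  by (simp add: cinner_def complex_eq_iff inner_commute)

lemma cinner_add_right: "cinner x (y + z) = cinner x y + cinner x z"
  by (simp add: cinner_def complex_eq_iff inner_add_right)

lemma cinner_scale_right: "cinner x (cplx_scale c y) = c * cinner x y"
  by (simp add: cinner_def cplx_scale_def complex_eq_iff inner_add_right inner_diff_right
      algebra_simps)

lemma cinner_cplx_of: "cinner (cplx_of a) (cplx_of b) = complex_of_real (a \<bullet> b)"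
  by (simp add: cinner_def cplx_of_def complex_eq_iff)


section \<open>The double Fock space\<close>

definition pm :: "nat \<Rightarrow> int set" where
  "pm n = {- int n..int n} - {0}"

text \<open>The algebraic tensor power of \<open>H\<close> with factors indexed by \<open>pm n\<close> is realised inside the
  complex functions of \<open>y\<close>, by means of the usual embedding: the elementary tensor of the family
  \<open>x\<close> is the conjugate multilinear functional sending \<open>y\<close> to the product of all
  \<open>\<langle>y i, x i\<rangle>\<close>. Only the values of a family on \<open>pm n\<close> matter.\<close>

type_synonym 'a tensor = "(int \<Rightarrow> 'a cplx) \<Rightarrow> complex"

definition tscale :: "complex \<Rightarrow> 'a tensor \<Rightarrow> 'a tensor" where
  "tscale c f = (\<lambda>y. c * f y)"

global_interpretation tensor: vector_space "tscale :: complex \<Rightarrow> 'a tensor \<Rightarrow> 'a tensor"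
  by unfold_locales (auto simp: tscale_def fun_eq_iff algebra_simps)

definition tens :: "nat \<Rightarrow> (int \<Rightarrow> 'a::real_inner cplx) \<Rightarrow> 'a tensor" where
  "tens n x = (\<lambda>y. \<Prod>i\<in>pm n. cinner (y i) (x i))"

definition K :: "nat \<Rightarrow> 'a::real_inner tensor set" where
  "K n = tensor.span (range (tens n))"

text \<open>The sesquilinear form on \<open>K n\<close> determined by its values on elementary tensors. The
  defining expression evaluates \<open>\<langle>\<Sum>x\<in>S. c x \<cdot> tens n x, g\<rangle>\<close>, since \<open>\<langle>tens n x, g\<rangle>\<close> is the value
  of the functional \<open>g\<close> at \<open>x\<close>; it does not depend on \<open>S\<close> and \<open>c\<close>. See the lemmas
  \<open>tinner_tens\<close>, \<open>tinner_add_right\<close>, \<open>tinner_scale_right\<close> and \<open>tinner_commute\<close>.\<close>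

definition tinner :: "nat \<Rightarrow> 'a::real_inner tensor \<Rightarrow> 'a tensor \<Rightarrow> complex" where
  "tinner n f g = (THE z. \<exists>S c. finite S \<and> f = (\<Sum>x\<in>S. tscale (c x) (tens n x)) \<and>
     z = (\<Sum>x\<in>S. cnj (c x) * g x))"

text \<open>Elements of the algebraic direct sum are the finitely supported sequences.\<close>

type_synonym 'a fock = "nat \<Rightarrow> 'a tensor"

definition F_fin :: "'a::real_inner fock set" where
  "F_fin = {f. (\<forall>n. f n \<in> K n) \<and> finite {n. f n \<noteq> 0}}"

definition vacuum :: "'a::real_inner fock" where
  "vacuum = (\<lambda>n. if n = 0 then tens 0 (\<lambda>_. 0) else 0)"

definition inner00 :: "'a::real_inner fock \<Rightarrow> 'a fock \<Rightarrow> complex" where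
  "inner00 f g = (\<Sum>n | f n \<noteq> 0. tinner n (f n) (g n))"


section \<open>The hyperoctahedral group and the deformed inner product\<close>

definition hyperoct :: "nat \<Rightarrow> (int \<Rightarrow> int) set" where
  "hyperoct n = {\<sigma>. \<sigma> permutes pm n \<and> (\<forall>i\<in>pm n. \<sigma> (- i) = - \<sigma> i)}"

definition cox_gen :: "nat \<Rightarrow> int \<Rightarrow> int" where
  "cox_gen k = (if k = 0 then Transposition.transpose (- 1) 1
     else Transposition.transpose (int k) (int k + 1) \<circ>
       Transposition.transpose (- int k) (- (int k + 1)))"

definition word_prod :: "nat list \<Rightarrow> int \<Rightarrow> int" where
  "word_prod w = foldr (\<lambda>k \<sigma>. cox_gen k \<circ> \<sigma>) w id"

definition is_expr :: "nat \<Rightarrow> (int \<Rightarrow> int) \<Rightarrow> nat list \<Rightarrow> bool" where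
  "is_expr n \<sigma> w \<longleftrightarrow> set w \<subseteq> {..<n} \<and> word_prod w = \<sigma>"

definition is_min_expr :: "nat \<Rightarrow> (int \<Rightarrow> int) \<Rightarrow> nat list \<Rightarrow> bool" where
  "is_min_expr n \<sigma> w \<longleftrightarrow> is_expr n \<sigma> w \<and> (\<forall>v. is_expr n \<sigma> v \<longrightarrow> length w \<le> length v)"

definition min_expr :: "nat \<Rightarrow> (int \<Rightarrow> int) \<Rightarrow> nat list" where
  "min_expr n \<sigma> = (SOME w. is_min_expr n \<sigma> w)"

definition l1 :: "nat \<Rightarrow> (int \<Rightarrow> int) \<Rightarrow> nat" where
  "l1 n \<sigma> = length (filter (\<lambda>k. k = 0) (min_expr n \<sigma>))"

definition l2 :: "nat \<Rightarrow> (int \<Rightarrow> int) \<Rightarrow> nat" where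
  "l2 n \<sigma> = length (filter (\<lambda>k. k \<noteq> 0) (min_expr n \<sigma>))"

text \<open>The action which sends the elementary tensor of \<open>x\<close> to that of \<open>x \<circ> \<sigma>\<inverse>\<close>; see \<open>act_tens\<close>.\<close>

definition act :: "(int \<Rightarrow> int) \<Rightarrow> 'a tensor \<Rightarrow> 'a tensor" where
  "act \<sigma> f = (\<lambda>y. f (y \<circ> \<sigma>))"

definition Pn :: "real \<Rightarrow> real \<Rightarrow> nat \<Rightarrow> 'a tensor \<Rightarrow> 'a tensor" where
  "Pn \<alpha> q n f =
     (\<Sum>\<sigma>\<in>hyperoct n. tscale (complex_of_real (\<alpha> ^ l1 n \<sigma> * q ^ l2 n \<sigma>)) (act \<sigma> f))"

definition dinner :: "real \<Rightarrow> real \<Rightarrow> 'a::real_inner fock \<Rightarrow> 'a fock \<Rightarrow> complex" where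
  "dinner \<alpha> q f g = inner00 f (\<lambda>n. Pn \<alpha> q n (g n))"


section \<open>Creation, annihilation and Gaussian operators\<close>

text \<open>The two new factors get the outermost indices \<open>- (n + 1)\<close> and \<open>n + 1\<close>; see
  \<open>bstar_tens\<close> and \<open>bstar_vacuum\<close>.\<close>

definition bstar :: "'a::real_inner cplx \<Rightarrow> 'a cplx \<Rightarrow> 'a fock \<Rightarrow> 'a fock" where
  "bstar x y f = (\<lambda>m. case m of 0 \<Rightarrow> 0
     | Suc n \<Rightarrow> (\<lambda>z. cinner (z (- int (Suc n))) x * f n z * cinner (z (int (Suc n))) y))"

text \<open>As for \<open>adjoint\<close> in the library, the adjoint is picked by a choice operator. It is unique on
  \<open>F_fin\<close> for \<open>\<alpha>, q \<in> (-1, 1)\<close> because \<open>dinner\<close> is then positive definite; its values outside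
  \<open>F_fin\<close> carry no meaning.\<close>

definition dadjoint :: "real \<Rightarrow> real \<Rightarrow> ('a::real_inner fock \<Rightarrow> 'a fock) \<Rightarrow> 'a fock \<Rightarrow> 'a fock" where
  "dadjoint \<alpha> q A = (SOME B. (\<forall>f\<in>F_fin. B f \<in> F_fin) \<and>
     (\<forall>f\<in>F_fin. \<forall>g\<in>F_fin. dinner \<alpha> q (B f) g = dinner \<alpha> q f (A g)))"

definition bann :: "real \<Rightarrow> real \<Rightarrow> 'a::real_inner cplx \<Rightarrow> 'a cplx \<Rightarrow> 'a fock \<Rightarrow> 'a fock" where
  "bann \<alpha> q x y = dadjoint \<alpha> q (bstar x y)"

definition Gauss :: "real \<Rightarrow> real \<Rightarrow> 'a::real_inner \<Rightarrow> 'a \<Rightarrow> 'a fock \<Rightarrow> 'a fock" where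
  "Gauss \<alpha> q x y f = bann \<alpha> q (cplx_of x) (cplx_of y) f + bstar (cplx_of x) (cplx_of y) f"

definition vacuum_state :: "real \<Rightarrow> real \<Rightarrow> ('a::real_inner fock \<Rightarrow> 'a fock) \<Rightarrow> complex" where
  "vacuum_state \<alpha> q A = dinner \<alpha> q vacuum (A vacuum)"

definition op_prod :: "('b \<Rightarrow> 'b) list \<Rightarrow> 'b \<Rightarrow> 'b" where
  "op_prod As = foldr (\<circ>) As id"


section \<open>Pair partitions of type B\<close>

definition pair_partitions_B :: "nat \<Rightarrow> int set set set" where
  "pair_partitions_B n = {\<pi>. partition_on (pm n) \<pi> \<and>
     (\<forall>V\<in>\<pi>. card V = 2 \<and> uminus ` V \<in> \<pi> \<and> uminus ` V \<noteq> V)}"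

text \<open>A block \<open>{i, j}\<close> with \<open>i < j\<close> is written as the pair \<open>(i, j)\<close>.\<close>

definition Pair_blocks :: "int set set \<Rightarrow> (int \<times> int) set" where
  "Pair_blocks \<pi> = {(i, j). i < j \<and> {i, j} \<in> \<pi>}"

definition reflect :: "int \<times> int \<Rightarrow> int \<times> int" where
  "reflect V = (- snd V, - fst V)"

definition Pair_B :: "int set set \<Rightarrow> ((int \<times> int) \<times> (int \<times> int)) set" where
  "Pair_B \<pi> = {(reflect (a, b), (a, b)) | a b.
     reflect (a, b) \<in> Pair_blocks \<pi> \<and> (a, b) \<in> Pair_blocks \<pi> \<and> b > 0 \<and> \<bar>a\<bar> < b}"

definition Nb :: "int set set \<Rightarrow> nat" where
  "Nb \<pi> = card {p \<in> Pair_B \<pi>. \<not> fst (snd p) * snd (snd p) > 0}"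

definition crosses :: "int \<times> int \<Rightarrow> int \<times> int \<Rightarrow> bool" where
  "crosses V W \<longleftrightarrow> fst V < fst W \<and> fst W < snd V \<and> snd V < snd W"

definition Cr :: "int set set \<Rightarrow> nat" where
  "Cr \<pi> =
     card {{p, p'} | p p'. p \<in> Pair_B \<pi> \<and> p' \<in> Pair_B \<pi> \<and> p \<noteq> p' \<and>
             (crosses (snd p) (snd p') \<or> crosses (snd p') (snd p))} +
     card {{p, p'} | p p'. p \<in> Pair_B \<pi> \<and> p' \<in> Pair_B \<pi> \<and> p \<noteq> p' \<and>
             crosses (fst p) (snd p')}"

lemma crosses_reflect: "crosses (reflect V) W \<longleftrightarrow> crosses (reflect W) V"
  by (auto simp: crosses_def reflect_def)


section \<open>The defining formulas on elementary tensors\<close>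

lemma finite_pm [simp]: "finite (pm n)"
  by (simp add: pm_def)

lemma sum_tensor_apply: "(\<Sum>x\<in>S. f x) (y :: int \<Rightarrow> 'a cplx) = (\<Sum>x\<in>S. (f x :: 'a tensor) y)"
  by (induction S rule: infinite_finite_induct) auto

lemma tens_commute: "tens n x y = cnj (tens n y x)"
  unfolding tens_def cnj_prod by (rule prod.cong) (auto intro: cinner_commute)

lemma K_expand:
  assumes "f \<in> K n"
  obtains S c where "finite S" "f = (\<Sum>x\<in>S. tscale (c x) (tens n x))"
proof -
  obtain T r where T: "finite T" "T \<subseteq> range (tens n)" "f = (\<Sum>a\<in>T. tscale (r a) a)"
    using assms unfolding K_def tensor.span_explicit by auto
  obtain S where S: "T = tens n ` S" "inj_on (tens n) S"
    using T(2) by (metis subset_image_inj)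
  have "finite S"
    using T(1) S finite_imageD by blast
  moreover have "f = (\<Sum>x\<in>S. tscale (r (tens n x)) (tens n x))"
    using T(3) S by (simp add: sum.reindex)
  ultimately show ?thesis
    by (rule that)
qed

lemma K_lincomb: "finite S \<Longrightarrow> (\<Sum>x\<in>S. tscale (c x) (tens n x)) \<in> K n"
  unfolding K_def
  by (intro tensor.span_sum tensor.span_scale tensor.span_base) auto

lemma tens_in_K: "tens n x \<in> K n"
  unfolding K_def by (rule tensor.span_base) auto

lemma lincomb_pairing:
  fixes c d :: "(int \<Rightarrow> 'a::real_inner cplx) \<Rightarrow> complex"
  assumes "f = (\<Sum>x\<in>S. tscale (c x) (tens n x))" "g = (\<Sum>y\<in>T. tscale (d y) (tens n y))"
  shows "(\<Sum>x\<in>S. cnj (c x) * g x) = cnj (\<Sum>y\<in>T. cnj (d y) * f y)"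
proof -
  have "(\<Sum>x\<in>S. cnj (c x) * g x) = (\<Sum>x\<in>S. \<Sum>y\<in>T. cnj (c x) * (d y * tens n y x))"
    unfolding assms(2) sum_tensor_apply by (simp add: tscale_def sum_distrib_left)
  also have "\<dots> = (\<Sum>y\<in>T. \<Sum>x\<in>S. cnj (c x) * (d y * tens n y x))"
    by (rule sum.swap)
  also have "\<dots> = (\<Sum>y\<in>T. \<Sum>x\<in>S. d y * cnj (c x * tens n x y))"
    by (intro sum.cong refl) (simp add: mult_ac flip: tens_commute)
  also have "\<dots> = cnj (\<Sum>y\<in>T. cnj (d y) * f y)"
    unfolding assms(1) sum_tensor_apply by (simp add: tscale_def sum_distrib_left)
  finally show ?thesis .
qed

lemma tinner_eq:
  assumes "finite S" "f = (\<Sum>x\<in>S. tscale (c x) (tens n x))" "g \<in> K n"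
  shows "tinner n f g = (\<Sum>x\<in>S. cnj (c x) * g x)"
proof -
  obtain T d where g: "finite T" "g = (\<Sum>y\<in>T. tscale (d y) (tens n y))"
    using assms(3) by (rule K_expand)
  show ?thesis
    unfolding tinner_def
  proof (rule the_equality)
    show "\<exists>S' c'. finite S' \<and> f = (\<Sum>x\<in>S'. tscale (c' x) (tens n x)) \<and>
        (\<Sum>x\<in>S. cnj (c x) * g x) = (\<Sum>x\<in>S'. cnj (c' x) * g x)"
      using assms by blast
    fix z
    assume "\<exists>S' c'. finite S' \<and> f = (\<Sum>x\<in>S'. tscale (c' x) (tens n x)) \<and>
      z = (\<Sum>x\<in>S'. cnj (c' x) * g x)"
    then obtain S' c' where f: "f = (\<Sum>x\<in>S'. tscale (c' x) (tens n x))"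
      and z: "z = (\<Sum>x\<in>S'. cnj (c' x) * g x)"
      by blast
    show "z = (\<Sum>x\<in>S. cnj (c x) * g x)"
      unfolding z lincomb_pairing[OF assms(2) g(2)] lincomb_pairing[OF f g(2)] ..
  qed
qed

lemma tinner_commute:
  assumes "f \<in> K n" "g \<in> K n"
  shows "tinner n g f = cnj (tinner n f g)"
proof -
  obtain S c where f: "finite S" "f = (\<Sum>x\<in>S. tscale (c x) (tens n x))"
    using assms(1) by (rule K_expand)
  obtain T d where g: "finite T" "g = (\<Sum>y\<in>T. tscale (d y) (tens n y))"
    using assms(2) by (rule K_expand)
  show ?thesis
    using tinner_eq[OF f assms(2)] tinner_eq[OF g assms(1)] lincomb_pairing[OF f(2) g(2)] by simp
qed

lemma tinner_add_right:
  assumes "f \<in> K n" "g \<in> K n" "h \<in> K n"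
  shows "tinner n f (g + h) = tinner n f g + tinner n f h"
proof -
  obtain S c where f: "finite S" "f = (\<Sum>x\<in>S. tscale (c x) (tens n x))"
    using assms(1) by (rule K_expand)
  have "g + h \<in> K n"
    using assms unfolding K_def by (intro tensor.span_add)
  then show ?thesis
    using assms by (simp add: tinner_eq[OF f] ring_distribs sum.distrib)
qed

lemma tinner_scale_right:
  assumes "f \<in> K n" "g \<in> K n"
  shows "tinner n f (tscale a g) = a * tinner n f g"
proof -
  obtain S c where f: "finite S" "f = (\<Sum>x\<in>S. tscale (c x) (tens n x))"
    using assms(1) by (rule K_expand)
  have "tscale a g \<in> K n"
    using assms unfolding K_def by (intro tensor.span_scale)
  then show ?thesis
    using assms by (simp add: tinner_eq[OF f] tscale_def sum_distrib_left mult_ac)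
qed

lemma tinner_tens: "tinner n (tens n x) (tens n y) = (\<Prod>i\<in>pm n. cinner (x i) (y i))"
  using tinner_eq[of "{x}" "tens n x" "\<lambda>_. 1" n "tens n y"]
  by (simp add: tens_in_K tscale_def) (simp add: tens_def)

lemma act_tens:
  assumes "\<sigma> \<in> hyperoct n"
  shows "act \<sigma> (tens n x) = tens n (x \<circ> inv \<sigma>)"
proof
  fix y
  have \<sigma>: "\<sigma> permutes pm n"
    using assms by (simp add: hyperoct_def)
  have "tens n (x \<circ> inv \<sigma>) y = (\<Prod>i\<in>pm n. cinner (y (\<sigma> i)) (x (inv \<sigma> (\<sigma> i))))"
    unfolding tens_def using prod.permute[OF \<sigma>, of "\<lambda>i. cinner (y i) ((x \<circ> inv \<sigma>) i)"]
    by (simp add: comp_def)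
  also have "\<dots> = act \<sigma> (tens n x) y"
    using permutes_inverses(2)[OF \<sigma>] by (simp add: act_def tens_def)
  finally show "act \<sigma> (tens n x) y = tens n (x \<circ> inv \<sigma>) y" ..
qed

lemma Pn_0: "Pn \<alpha> q 0 f = f"
proof -
  have pm0: "pm 0 = {}"
    by (auto simp: pm_def)
  have h: "hyperoct 0 = {id}"
    unfolding hyperoct_def pm0 by (auto simp: permutes_id)
  have *: "is_min_expr 0 id w \<longleftrightarrow> w = []" for w
    by (auto simp: is_min_expr_def is_expr_def word_prod_def)
  have "min_expr 0 id = []"
    by (simp add: min_expr_def *)
  then show ?thesis
    by (simp add: Pn_def h l1_def l2_def act_def tscale_def)
qed

lemma pm_Suc: "pm (Suc n) = insert (- int (Suc n)) (insert (int (Suc n)) (pm n))"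
  by (auto simp: pm_def)

lemma bstar_tens:
  assumes "f n = tens n z"
  shows "bstar x y f (Suc n) = tens (Suc n) (z(- int (Suc n) := x, int (Suc n) := y))"
proof -
  have "(\<Prod>i\<in>pm n. cinner (w i) ((z(- int (Suc n) := x, int (Suc n) := y)) i)) =
      (\<Prod>i\<in>pm n. cinner (w i) (z i))" for w
    by (rule prod.cong) (auto simp: pm_def)
  moreover have "- int (Suc n) \<notin> insert (int (Suc n)) (pm n)" "int (Suc n) \<notin> pm n"
    by (auto simp: pm_def)
  ultimately show ?thesis
    using assms by (simp add: bstar_def fun_eq_iff tens_def pm_Suc mult_ac del: of_nat_Suc)
qed

lemma bstar_vacuum:
  "bstar x y vacuum = (\<lambda>n. if n = 1 then tens 1 (\<lambda>i. if i < 0 then x else y) else 0)"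
proof
  fix n
  have "pm 0 = {}" "pm 1 = {-1, 1}"
    by (auto simp: pm_def)
  then show "bstar x y vacuum n = (if n = 1 then tens 1 (\<lambda>i. if i < 0 then x else y) else 0)"
    by (auto simp: bstar_def vacuum_def tens_def fun_eq_iff split: nat.split)
qed

end

theory Submission
  imports Defs
begin

text \<open>Every element of \<open>B(n+1)\<close> is uniquely \<open>\<rho>\<^sub>k \<circ> \<tau>\<close> with \<open>\<tau> \<in> B(n)\<close> and \<open>\<rho>\<^sub>k\<close> the minimal coset
  representative sending \<open>n+1\<close> to \<open>k\<close>, and \<open>l\<^sub>1\<close> and \<open>l\<^sub>2\<close> add up along this factorization. Hence the
  annihilation operator acts on an elementary tensor by deleting, for each \<open>k \<in> [\<plusminus>(n+1)]\<close>, the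
  factors of index \<open>\<plusminus>k\<close>, with the weight \<open>\<alpha>\<^bsup>[k<0]\<^esup> q\<^bsup>c\<^esup>\<close>, where \<open>c\<close> is the number of the remaining
  indices above \<open>k\<close>. When the product of the Gaussian operators is applied to the vacuum, creation
  opens an index and annihilation closes one. The weight of the step that closes the arc
  \<open>(a, b)\<close> is \<open>\<alpha>\<^bsup>[a<0]\<^esup> q\<^bsup>c\<^esup>\<close>, where \<open>c\<close> counts the crossings, of both kinds, with the
  arcs that are closed later.\<close>

text \<open>\<open>l1\<close> and \<open>l2\<close> are read off a minimal word picked by choice.
  They are first identified with two root statistics, for which additivity over cosets is a count.
  The crossing weight comes out right for the following reason. Open indices come in pairs
  \<open>t\<close>, \<open>- t\<close>, and one later arc consumes both, with left end
  \<open>t\<close> or \<open>- t\<close>. When \<open>(a, b)\<close> closes, all open indices are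
  below \<open>b\<close> in absolute value and all later right ends exceed \<open>b\<close>. So an
  open \<open>t > a\<close> other than \<open>- a\<close> contributes one crossing: the later arc
  crosses \<open>(a, b)\<close> if it starts at \<open>t\<close>, and the mirror image
  \<open>(- b, - a)\<close> if it starts at \<open>- t\<close>. Deleting factors renumbers the rest,
  so tensor positions differ from the original indices. The weights depend only on sign and order,
  which an increasing odd relabelling preserves. The combinatorial sum is generalised to all
  completions of a given set of open indices. In this form it obeys the same one-step recursion as
  the remaining operators on an elementary tensor, which replaces an expansion into words of
  creations and annihilations.\<close>

lemma hyperoct_permutes: "\<sigma> \<in> hyperoct n \<Longrightarrow> \<sigma> permutes pm n"
  by (simp add: hyperoct_def)

lemma uminus_pm_iff [simp]: "- i \<in> pm n \<longleftrightarrow> i \<in> pm n"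
  by (auto simp: pm_def)

lemma hyperoct_minus:
  assumes "\<sigma> \<in> hyperoct n"
  shows "\<sigma> (- i) = - \<sigma> i"
proof (cases "i \<in> pm n")
  case False
  then have "- i \<notin> pm n"
    by simp
  with False show ?thesis
    using hyperoct_permutes[OF assms] by (simp add: permutes_not_in)
qed (use assms in \<open>simp add: hyperoct_def\<close>)

lemma hyperoct_inj: "\<sigma> \<in> hyperoct n \<Longrightarrow> \<sigma> i = \<sigma> j \<longleftrightarrow> i = j"
  using hyperoct_permutes permutes_inj injD by metis

lemma hyperoct_in_pm: "\<sigma> \<in> hyperoct n \<Longrightarrow> \<sigma> i \<in> pm n \<longleftrightarrow> i \<in> pm n"
  using hyperoct_permutes permutes_in_image by metis

lemma hyperoct_id: "id \<in> hyperoct n"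
  by (simp add: hyperoct_def permutes_id)

lemma hyperoct_comp:
  assumes "\<sigma> \<in> hyperoct n" "\<tau> \<in> hyperoct n"
  shows "\<sigma> \<circ> \<tau> \<in> hyperoct n"
  using assms permutes_compose[OF hyperoct_permutes hyperoct_permutes, OF assms(2) assms(1)]
  by (simp add: hyperoct_def hyperoct_minus[OF assms(1)])

lemma hyperoct_inv_apply:
  assumes "\<sigma> \<in> hyperoct n"
  shows "inv \<sigma> (\<sigma> i) = i" "\<sigma> (inv \<sigma> i) = i"
  using permutes_inverses[OF hyperoct_permutes[OF assms]] by auto

lemma hyperoct_inv:
  assumes "\<sigma> \<in> hyperoct n"
  shows "inv \<sigma> \<in> hyperoct n"
proof -
  have "inv \<sigma> (- i) = - inv \<sigma> i" for i
    by (metis assms hyperoct_inv_apply hyperoct_minus)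
  then show ?thesis
    using permutes_inv[OF hyperoct_permutes[OF assms]] by (simp add: hyperoct_def)
qed

lemma finite_hyperoct [simp]: "finite (hyperoct n)"
  using finite_permutations[of "pm n"] by (rule rev_finite_subset) (auto simp: hyperoct_def)


section \<open>Length functions of the hyperoctahedral group\<close>

text \<open>With \<open>e_(-i) = - e_i\<close>, this set and \<open>inv_set\<close> list the
  positive roots \<open>e_j\<close> and \<open>e_j - e_i\<close> that \<open>\<sigma>\<close> makes
  negative. The two kinds of roots correspond to the two kinds of generators.\<close>

definition neg_set :: "nat \<Rightarrow> (int \<Rightarrow> int) \<Rightarrow> int set" where
  "neg_set n \<sigma> = {j. 0 < j \<and> j \<le> int n \<and> \<sigma> j < 0}"

definition inv_set :: "nat \<Rightarrow> (int \<Rightarrow> int) \<Rightarrow> (int \<times> int) set" where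
  "inv_set n \<sigma> = {(i, j). i \<in> pm n \<and> \<bar>i\<bar> < j \<and> j \<le> int n \<and> \<sigma> j < \<sigma> i}"

lemma finite_neg_set [simp]: "finite (neg_set n \<sigma>)"
  by (rule finite_subset[of _ "{1..int n}"]) (auto simp: neg_set_def)

lemma finite_inv_set [simp]: "finite (inv_set n \<sigma>)"
  by (rule finite_subset[of _ "pm n \<times> {1..int n}"]) (auto simp: inv_set_def)

lemma cox_gen_0: "cox_gen 0 t = (if t = 1 then -1 else if t = -1 then 1 else t)"
  by (auto simp: cox_gen_def transpose_def)

lemma cox_gen_pos:
  assumes "k > 0"
  shows "cox_gen k t = (if t = int k then int k + 1 else if t = int k + 1 then int k
    else if t = - int k then - (int k + 1) else if t = - (int k + 1) then - int k else t)"
  using assms by (auto simp: cox_gen_def transpose_def)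

lemma cox_gen_involutive: "cox_gen k (cox_gen k t) = t"
  by (cases "k = 0") (auto simp: cox_gen_0 cox_gen_pos)

lemma cox_gen_hyperoct:
  assumes "k < n"
  shows "cox_gen k \<in> hyperoct n"
proof -
  have "cox_gen k permutes pm n"
  proof (rule bij_imp_permutes)
    have "cox_gen k t \<in> pm n" if "t \<in> pm n" for t
      using that assms by (cases "k = 0") (auto simp: cox_gen_0 cox_gen_pos pm_def)
    then show "bij_betw (cox_gen k) (pm n) (pm n)"
      by (intro bij_betwI[of _ _ _ "cox_gen k"]) (auto simp: cox_gen_involutive)
    show "cox_gen k t = t" if "t \<notin> pm n" for t
      using that assms by (cases "k = 0") (auto simp: cox_gen_0 cox_gen_pos pm_def)
  qed
  moreover have "cox_gen k (- t) = - cox_gen k t" for t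
    by (cases "k = 0") (auto simp: cox_gen_0 cox_gen_pos)
  ultimately show ?thesis
    by (simp add: hyperoct_def)
qed

lemma neg_set_cox_gen_pos:
  "k > 0 \<Longrightarrow> neg_set n (cox_gen k \<circ> \<sigma>) = neg_set n \<sigma>"
  unfolding neg_set_def comp_def by (auto simp: cox_gen_pos split: if_splits)

text \<open>Composition with \<open>cox_gen 0\<close> on the left flips the sign of the values 1 and
  -1 only, so membership can change only at the position \<open>\<bar>inv \<sigma> 1\<bar>\<close>.
  The second clause is the descent case.\<close>

lemma neg_set_cox_gen_0:
  assumes "\<sigma> \<in> hyperoct n"
  obtains e where "neg_set n (cox_gen 0 \<circ> \<sigma>) \<subseteq> insert e (neg_set n \<sigma>)"
    "inv \<sigma> 1 < 0 \<Longrightarrow> n > 0 \<Longrightarrow> e \<in> neg_set n \<sigma> \<and> neg_set n (cox_gen 0 \<circ> \<sigma>) = neg_set n \<sigma> - {e}"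
proof
  let ?u = "inv \<sigma> 1"
  have su: "\<sigma> ?u = 1" "\<sigma> (- ?u) = -1"
    by (simp_all add: hyperoct_inv_apply[OF assms] hyperoct_minus[OF assms])
  have neg': "\<sigma> (- ?u) < 0"
    by (simp add: su)
  have u: "\<sigma> t = 1 \<longleftrightarrow> t = ?u" "\<sigma> t = -1 \<longleftrightarrow> t = - ?u" for t
    using hyperoct_inj[OF assms, of t ?u] hyperoct_inj[OF assms, of t "- ?u"] su by simp_all
  show "neg_set n (cox_gen 0 \<circ> \<sigma>) \<subseteq> insert \<bar>?u\<bar> (neg_set n \<sigma>)"
    using u by (auto simp: neg_set_def cox_gen_0 split: if_splits)
  assume neg: "?u < 0" and "n > 0"
  then have "?u \<in> pm n"
    using hyperoct_in_pm[OF hyperoct_inv[OF assms], of 1] by (auto simp: pm_def)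
  then show "\<bar>?u\<bar> \<in> neg_set n \<sigma> \<and> neg_set n (cox_gen 0 \<circ> \<sigma>) = neg_set n \<sigma> - {\<bar>?u\<bar>}"
    using neg neg' by (auto simp: neg_set_def cox_gen_0 pm_def u split: if_splits)
qed

text \<open>The generator \<open>\<pi>\<^sub>0\<close> only exchanges the order of the values \<open>\<plusminus>1\<close>, which sit at opposite positions.\<close>

lemma inv_set_cox_gen_0:
  assumes "\<sigma> \<in> hyperoct n"
  shows "inv_set n (cox_gen 0 \<circ> \<sigma>) = inv_set n \<sigma>"
proof -
  have "cox_gen 0 (\<sigma> j) < cox_gen 0 (\<sigma> i) \<longleftrightarrow> \<sigma> j < \<sigma> i" if "i \<in> pm n" "\<bar>i\<bar> < j" "j \<le> int n" for i j
  proof -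
    have "\<sigma> i \<noteq> \<sigma> j"
      using that hyperoct_inj[OF assms, of i j] by auto
    moreover have "\<sigma> i \<noteq> - \<sigma> j"
      using that hyperoct_inj[OF assms, of i "- j"] by (auto simp: hyperoct_minus[OF assms])
    moreover have "\<sigma> i \<in> pm n" "\<sigma> j \<in> pm n"
      using that unfolding hyperoct_in_pm[OF assms] by (auto simp: pm_def)
    ultimately show ?thesis
      by (auto simp: cox_gen_0 pm_def)
  qed
  then show ?thesis
    by (auto simp: inv_set_def)
qed

text \<open>Exchanging the adjacent values \<open>k\<close> and \<open>k + 1\<close>, and their
  negatives, leaves every other comparison of values unchanged. By oddness the pair of positions and
  the pair of their negatives count as one, so a single \<open>e\<close> accounts for the
  change.\<close>

lemma inv_set_cox_gen_pos:
  assumes \<sigma>: "\<sigma> \<in> hyperoct n" and k: "0 < k" "k < n"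
  obtains e where "inv_set n (cox_gen k \<circ> \<sigma>) \<subseteq> insert e (inv_set n \<sigma>)"
    "inv \<sigma> (int k + 1) < inv \<sigma> (int k) \<Longrightarrow>
      e \<in> inv_set n \<sigma> \<and> inv_set n (cox_gen k \<circ> \<sigma>) = inv_set n \<sigma> - {e}"
proof
  define u v where "u = inv \<sigma> (int k)" and "v = inv \<sigma> (int k + 1)"
  \<comment> \<open>Of the pairs formed by the positions \<open>u\<close>, \<open>v\<close> or by
    \<open>- u\<close>, \<open>- v\<close>, this is the one admissible in \<open>inv_set\<close>:
    its second entry is positive and larger in absolute value.\<close>
  define e where "e = (if \<bar>u\<bar> < \<bar>v\<bar> then if v > 0 then (u, v) else (- u, - v)
    else if u > 0 then (v, u) else (- v, - u))"
  have su: "\<sigma> u = int k" "\<sigma> (- u) = - int k"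
    and sv: "\<sigma> v = int k + 1" "\<sigma> (- v) = - (int k + 1)"
    using \<sigma> by (auto simp: u_def v_def hyperoct_inv_apply hyperoct_minus)
  have val: "\<sigma> t = int k \<longleftrightarrow> t = u" "\<sigma> t = - int k \<longleftrightarrow> t = - u"
    "\<sigma> t = int k + 1 \<longleftrightarrow> t = v" "\<sigma> t = - (int k + 1) \<longleftrightarrow> t = - v" for t
    using hyperoct_inj[OF \<sigma>] su sv by metis+
  have uv: "u \<in> pm n" "v \<in> pm n"
    using k hyperoct_in_pm[OF hyperoct_inv[OF \<sigma>]] by (auto simp: u_def v_def pm_def)
  have ne: "u \<noteq> v" "u \<noteq> - v"
    using su sv by auto
  have swap: "cox_gen k s < cox_gen k t \<longleftrightarrow>
      (if s = int k \<and> t = int k + 1 \<or> s = - (int k + 1) \<and> t = - int k then False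
       else if t = int k \<and> s = int k + 1 \<or> t = - (int k + 1) \<and> s = - int k then True
       else s < t)" for s t
    using k by (auto simp: cox_gen_pos)
  have iff: "(i, j) \<in> inv_set n (cox_gen k \<circ> \<sigma>) \<longleftrightarrow> i \<in> pm n \<and> \<bar>i\<bar> < j \<and> j \<le> int n \<and>
     (if j = u \<and> i = v \<or> j = - v \<and> i = - u then False
       else if i = u \<and> j = v \<or> i = - v \<and> j = - u then True
       else \<sigma> j < \<sigma> i)" for i j
    unfolding inv_set_def by (simp only: swap comp_def val mem_Collect_eq case_prod_conv)
  have e1: "(i, j) = e" if "\<bar>i\<bar> < j" "i = u \<and> j = v \<or> i = - v \<and> j = - u" for i j
    using that by (auto simp: e_def)
  show "inv_set n (cox_gen k \<circ> \<sigma>) \<subseteq> insert e (inv_set n \<sigma>)"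
    using iff e1 by (auto simp: inv_set_def split: if_splits)
  assume "inv \<sigma> (int k + 1) < inv \<sigma> (int k)"
  then have less: "v < u"
    by (simp add: u_def v_def)
  have e2: "e = (- u, - v) \<and> \<bar>u\<bar> < - v \<or> e = (v, u) \<and> \<bar>v\<bar> < u"
    using less ne by (auto simp: e_def)
  have e3: "e \<in> inv_set n \<sigma>"
    using e2 su sv uv by (auto simp: inv_set_def pm_def)
  have e4: "(i, j) = e \<longleftrightarrow> j = u \<and> i = v \<or> j = - v \<and> i = - u" if "\<bar>i\<bar> < j" for i j
    using e2 that by auto
  have e5: "\<not> (i = u \<and> j = v \<or> i = - v \<and> j = - u)" if "\<bar>i\<bar> < j" for i j
    using less that by auto
  have "(i, j) \<in> inv_set n (cox_gen k \<circ> \<sigma>) \<longleftrightarrow> (i, j) \<in> inv_set n \<sigma> - {e}" for i j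
  proof (cases "\<bar>i\<bar> < j")
    case True
    show ?thesis
      unfolding iff Diff_iff singleton_iff e4[OF True] using e5[OF True] by (auto simp: inv_set_def)
  qed (simp add: inv_set_def)
  then have "inv_set n (cox_gen k \<circ> \<sigma>) = inv_set n \<sigma> - {e}"
    by (auto simp del: Diff_iff)
  with e3 show "e \<in> inv_set n \<sigma> \<and> inv_set n (cox_gen k \<circ> \<sigma>) = inv_set n \<sigma> - {e}"
    by blast
qed

lemma word_prod_Cons: "word_prod (k # w) = cox_gen k \<circ> word_prod w"
  by (simp add: word_prod_def)

lemma word_prod_hyperoct: "set w \<subseteq> {..<n} \<Longrightarrow> word_prod w \<in> hyperoct n"
proof (induction w)
  case Nil
  then show ?case
    using hyperoct_id by (simp add: word_prod_def id_def)
next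
  case (Cons k w)
  then show ?case
    unfolding word_prod_Cons by (intro hyperoct_comp cox_gen_hyperoct) auto
qed

text \<open>A letter can raise only the statistic of its own kind, and by at most one. The word is
  arbitrary, so the bound applies to whichever minimal word the choice returns.\<close>

lemma stat_le_word:
  assumes "set w \<subseteq> {..<n}"
  shows "card (neg_set n (word_prod w)) \<le> length (filter (\<lambda>k. k = 0) w) \<and>
    card (inv_set n (word_prod w)) \<le> length (filter (\<lambda>k. k \<noteq> 0) w)"
  using assms
proof (induction w)
  case Nil
  have "neg_set n id = {}" "inv_set n id = {}"
    by (auto simp: neg_set_def inv_set_def)
  then show ?case
    by (simp add: word_prod_def flip: id_def)
next
  case (Cons k w)
  let ?\<sigma> = "word_prod w"
  have \<sigma>: "?\<sigma> \<in> hyperoct n" and k: "k < n"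
    using Cons.prems by (auto intro: word_prod_hyperoct)
  have card_insert: "A \<subseteq> insert e B \<Longrightarrow> finite B \<Longrightarrow> card A \<le> Suc (card B)" for A B :: "'b set" and e
    by (metis card_insert_le_m1 card_mono diff_Suc_1 finite_insert le_trans order_refl zero_less_Suc)
  have "card (neg_set n (cox_gen k \<circ> ?\<sigma>)) \<le> length (filter (\<lambda>k. k = 0) (k # w)) \<and>
    card (inv_set n (cox_gen k \<circ> ?\<sigma>)) \<le> length (filter (\<lambda>k. k \<noteq> 0) (k # w))"
  proof (cases "k = 0")
    case True
    obtain e where "neg_set n (cox_gen 0 \<circ> ?\<sigma>) \<subseteq> insert e (neg_set n ?\<sigma>)"
      using neg_set_cox_gen_0[OF \<sigma>] by metis
    then have "card (neg_set n (cox_gen 0 \<circ> ?\<sigma>)) \<le> Suc (card (neg_set n ?\<sigma>))"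
      by (rule card_insert) simp
    then show ?thesis
      using Cons True inv_set_cox_gen_0[OF \<sigma>] by auto
  next
    case False
    obtain e where "inv_set n (cox_gen k \<circ> ?\<sigma>) \<subseteq> insert e (inv_set n ?\<sigma>)"
      using inv_set_cox_gen_pos[OF \<sigma>] False k by (metis neq0_conv)
    then have "card (inv_set n (cox_gen k \<circ> ?\<sigma>)) \<le> Suc (card (inv_set n ?\<sigma>))"
      by (rule card_insert) simp
    then show ?thesis
      using Cons False neg_set_cox_gen_pos[of k n ?\<sigma>] by auto
  qed
  then show ?case
    unfolding word_prod_Cons .
qed

text \<open>Integer steps of at least 1 from a positive start give
  \<open>int k \<le> f (int k)\<close>; counting back from the bound \<open>n\<close> gives the
  converse.\<close>

lemma strict_mono_chain_id:
  fixes f :: "int \<Rightarrow> int"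
  assumes "0 < n \<Longrightarrow> f 1 > 0" "\<And>k. 0 < k \<Longrightarrow> k < n \<Longrightarrow> f (int k) < f (int k + 1)"
    "\<And>k. 0 < k \<Longrightarrow> k \<le> n \<Longrightarrow> f (int k) \<le> int n" "0 < k" "k \<le> n"
  shows "f (int k) = int k"
proof -
  have lower: "0 < j \<Longrightarrow> j \<le> n \<Longrightarrow> int j \<le> f (int j)" for j
  proof (induction j)
    case (Suc j)
    show ?case
    proof (cases "j = 0")
      case False
      then show ?thesis
        using Suc assms(2)[of j] by (simp add: add.commute)
    qed (use Suc assms(1) in auto)
  qed simp
  have upper: "f (int j) \<le> int j" if "0 < j" "j \<le> n" for j
    using that(2,1)
  proof (induction rule: inc_induct)
    case base
    then show ?case
      using assms(3)[of n] by simp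
  next
    case (step m)
    then show ?case
      using assms(2)[of m] by (simp add: add.commute)
  qed
  show ?thesis
    using lower upper assms(4,5) by (simp add: antisym)
qed

lemma hyperoct_eq_id:
  assumes \<sigma>: "\<sigma> \<in> hyperoct n" and 0: "n > 0 \<Longrightarrow> \<sigma> 1 > 0"
    and inc: "\<And>k. 0 < k \<Longrightarrow> k < n \<Longrightarrow> \<sigma> (int k) < \<sigma> (int k + 1)"
  shows "\<sigma> = id"
proof -
  have bound: "\<sigma> (int k) \<le> int n" if "0 < k" "k \<le> n" for k
    using that hyperoct_in_pm[OF \<sigma>, of "int k"] by (auto simp: pm_def)
  have pos: "\<sigma> (int k) = int k" if "0 < k" "k \<le> n" for k
    using strict_mono_chain_id[of n \<sigma>, OF 0 inc bound that] by blast
  have "\<sigma> i = i" for i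
  proof (cases "i \<in> pm n")
    case True
    show ?thesis
    proof (cases "i > 0")
      case True
      then show ?thesis
        using pos[of "nat i"] \<open>i \<in> pm n\<close> by (auto simp: pm_def)
    next
      case False
      then show ?thesis
        using pos[of "nat (- i)"] hyperoct_minus[OF \<sigma>, of i] \<open>i \<in> pm n\<close> by (auto simp: pm_def)
    qed
  qed (use hyperoct_permutes[OF \<sigma>] in \<open>simp add: permutes_not_in\<close>)
  then show ?thesis
    by auto
qed

text \<open>Stripping a left letter at a descent of \<open>inv \<sigma>\<close> lowers exactly one
  statistic, by one. Without descents \<open>inv \<sigma>\<close> is positive and increasing on
  \<open>1..n\<close>, hence the identity.\<close>

lemma reduced_word_exists:
  assumes "\<sigma> \<in> hyperoct n"
  shows "\<exists>w. is_expr n \<sigma> w \<and> length (filter (\<lambda>k. k = 0) w) = card (neg_set n \<sigma>) \<and>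
    length (filter (\<lambda>k. k \<noteq> 0) w) = card (inv_set n \<sigma>)"
  using assms
proof (induction "card (neg_set n \<sigma>) + card (inv_set n \<sigma>)" arbitrary: \<sigma> rule: less_induct)
  case less
  note \<sigma> = less.prems
  have ext: ?case if k: "k < n" and len: "\<And>w. length (filter (\<lambda>k. k = 0) w) = card (neg_set n (cox_gen k \<circ> \<sigma>)) \<Longrightarrow>
      length (filter (\<lambda>k. k \<noteq> 0) w) = card (inv_set n (cox_gen k \<circ> \<sigma>)) \<Longrightarrow>
      length (filter (\<lambda>k. k = 0) (k # w)) = card (neg_set n \<sigma>) \<and>
      length (filter (\<lambda>k. k \<noteq> 0) (k # w)) = card (inv_set n \<sigma>)"
    and less': "card (neg_set n (cox_gen k \<circ> \<sigma>)) + card (inv_set n (cox_gen k \<circ> \<sigma>))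
      < card (neg_set n \<sigma>) + card (inv_set n \<sigma>)" for k
  proof -
    obtain w where w: "is_expr n (cox_gen k \<circ> \<sigma>) w"
      "length (filter (\<lambda>k. k = 0) w) = card (neg_set n (cox_gen k \<circ> \<sigma>))"
      "length (filter (\<lambda>k. k \<noteq> 0) w) = card (inv_set n (cox_gen k \<circ> \<sigma>))"
      using less.hyps[OF less' hyperoct_comp[OF cox_gen_hyperoct[OF k] \<sigma>]] by blast
    have "is_expr n \<sigma> (k # w)"
      using w(1) k by (auto simp: is_expr_def word_prod_Cons fun_eq_iff cox_gen_involutive)
    with len[OF w(2,3)] show ?thesis
      by blast
  qed
  consider "n > 0" "inv \<sigma> 1 < 0" | k where "0 < k" "k < n" "inv \<sigma> (int k + 1) < inv \<sigma> (int k)"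
    | "\<sigma> = id"
  proof -
    have "\<sigma> = id" if "\<not> (n > 0 \<and> inv \<sigma> 1 < 0)"
      "\<And>k. 0 < k \<Longrightarrow> k < n \<Longrightarrow> \<not> inv \<sigma> (int k + 1) < inv \<sigma> (int k)"
    proof -
      have "inv \<sigma> = id"
      proof (rule hyperoct_eq_id[OF hyperoct_inv[OF \<sigma>]])
        show "0 < inv \<sigma> 1" if "n > 0"
          using that \<open>\<not> (n > 0 \<and> _)\<close> hyperoct_in_pm[OF hyperoct_inv[OF \<sigma>], of 1]
          by (auto simp: pm_def not_less le_less)
        show "inv \<sigma> (int k) < inv \<sigma> (int k + 1)" if "0 < k" "k < n" for k
          using that \<open>\<And>k. _ \<Longrightarrow> _ \<Longrightarrow> \<not> inv \<sigma> (int k + 1) < inv \<sigma> (int k)\<close>[OF that]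
            hyperoct_inj[OF hyperoct_inv[OF \<sigma>], of "int k" "int k + 1"]
          by linarith
      qed
      then show ?thesis
        using hyperoct_inv_apply(2)[OF \<sigma>] by (simp add: fun_eq_iff)
    qed
    then show thesis
      using that by blast
  qed
  then show ?case
  proof cases
    case 1
    obtain e where e: "e \<in> neg_set n \<sigma>" "neg_set n (cox_gen 0 \<circ> \<sigma>) = neg_set n \<sigma> - {e}"
      using neg_set_cox_gen_0[OF \<sigma>] 1 by metis
    have card: "card (neg_set n \<sigma>) = Suc (card (neg_set n (cox_gen 0 \<circ> \<sigma>)))"
      using card_Suc_Diff1[OF finite_neg_set e(1)] e(2) by simp
    show ?thesis
      by (rule ext[OF 1(1)]) (auto simp: card inv_set_cox_gen_0[OF \<sigma>])
  next
    case 2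
    obtain e where e: "e \<in> inv_set n \<sigma>" "inv_set n (cox_gen k \<circ> \<sigma>) = inv_set n \<sigma> - {e}"
      using inv_set_cox_gen_pos[OF \<sigma> 2(1,2)] 2(3) by metis
    have card: "card (inv_set n \<sigma>) = Suc (card (inv_set n (cox_gen k \<circ> \<sigma>)))"
      using card_Suc_Diff1[OF finite_inv_set e(1)] e(2) by simp
    show ?thesis
      by (rule ext[OF 2(2)]) (use 2(1) in \<open>auto simp: card neg_set_cox_gen_pos\<close>)
  next
    case 3
    have "neg_set n id = {}" "inv_set n id = {}"
      by (auto simp: neg_set_def inv_set_def)
    then show ?thesis
      using 3 by (intro exI[of _ "[]"]) (auto simp: is_expr_def word_prod_def)
  qed
qed

lemma length_filter_split: "length w = length (filter (\<lambda>k. k = 0) w) + length (filter (\<lambda>k. k \<noteq> 0) w)"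
  for w :: "nat list"
  using sum_length_filter_compl[of "\<lambda>k. k = 0" w] by simp

text \<open>Any word has letter counts at least the two statistics, and some word attains both. So a
  minimal word has their sum as its length, which forces each count separately, whatever the choice
  in \<open>min_expr\<close>.\<close>

lemma l1_l2_eq:
  assumes "\<sigma> \<in> hyperoct n"
  shows "l1 n \<sigma> = card (neg_set n \<sigma>)" "l2 n \<sigma> = card (inv_set n \<sigma>)"
proof -
  obtain w where w: "is_expr n \<sigma> w" "length (filter (\<lambda>k. k = 0) w) = card (neg_set n \<sigma>)"
    "length (filter (\<lambda>k. k \<noteq> 0) w) = card (inv_set n \<sigma>)"
    using reduced_word_exists[OF assms] by blast
  have ge: "card (neg_set n \<sigma>) \<le> length (filter (\<lambda>k. k = 0) v)"
    "card (inv_set n \<sigma>) \<le> length (filter (\<lambda>k. k \<noteq> 0) v)" if "is_expr n \<sigma> v" for v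
    using that stat_le_word[of v n] by (auto simp: is_expr_def)
  have "is_min_expr n \<sigma> w"
    unfolding is_min_expr_def
    using w ge length_filter_split by (metis add_mono)
  then have "is_min_expr n \<sigma> (min_expr n \<sigma>)"
    unfolding min_expr_def by (rule someI)
  then have "is_expr n \<sigma> (min_expr n \<sigma>)" "length (min_expr n \<sigma>) \<le> length w"
    using w(1) by (auto simp: is_min_expr_def)
  then show "l1 n \<sigma> = card (neg_set n \<sigma>)" "l2 n \<sigma> = card (inv_set n \<sigma>)"
    using ge[of "min_expr n \<sigma>"] w(2,3) length_filter_split[of w]
      length_filter_split[of "min_expr n \<sigma>"]
    unfolding l1_def l2_def by linarith+
qed

lemma word_prod_rev: "word_prod (rev w) \<circ> word_prod w = id"
proof (induction w)
  case (Cons k w)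
  have "word_prod (v @ [k]) = word_prod v \<circ> cox_gen k" for v
    by (induction v) (auto simp: word_prod_def)
  with Cons show ?case
    by (auto simp: word_prod_Cons fun_eq_iff cox_gen_involutive)
qed (simp add: word_prod_def)

text \<open>Reversing a word inverts its product and keeps the letters. This gives one inequality;
  applied to the inverse it gives the other.\<close>

lemma l1_l2_inv:
  assumes "\<sigma> \<in> hyperoct n"
  shows "l1 n (inv \<sigma>) = l1 n \<sigma>" "l2 n (inv \<sigma>) = l2 n \<sigma>"
proof -
  have le: "l1 n (inv \<tau>) \<le> l1 n \<tau> \<and> l2 n (inv \<tau>) \<le> l2 n \<tau>" if \<tau>: "\<tau> \<in> hyperoct n" for \<tau>
  proof -
    obtain w where w: "is_expr n \<tau> w" "length (filter (\<lambda>k. k = 0) w) = card (neg_set n \<tau>)"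
      "length (filter (\<lambda>k. k \<noteq> 0) w) = card (inv_set n \<tau>)"
      using reduced_word_exists[OF \<tau>] by blast
    have "word_prod (rev w) (\<tau> i) = i" for i
      using word_prod_rev[of w] w(1) by (auto simp: is_expr_def fun_eq_iff)
    then have "word_prod (rev w) = inv \<tau>"
      by (metis ext hyperoct_inv_apply(2)[OF \<tau>])
    then show ?thesis
      using stat_le_word[of "rev w" n] w l1_l2_eq[OF \<tau>] l1_l2_eq[OF hyperoct_inv[OF \<tau>]]
      by (auto simp: is_expr_def simp flip: rev_filter)
  qed
  have "inv (inv \<sigma>) = \<sigma>"
    using permutes_inv_inv[OF hyperoct_permutes[OF assms]] .
  then show "l1 n (inv \<sigma>) = l1 n \<sigma>" "l2 n (inv \<sigma>) = l2 n \<sigma>"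
    using le[OF assms] le[OF hyperoct_inv[OF assms]] by auto
qed


section \<open>Coset representatives\<close>

text \<open>The minimal representative, modulo \<open>B(n)\<close>, of the elements of \<open>B(n+1)\<close> that send \<open>n+1\<close> to \<open>k\<close>.
  Composing a family with it removes the factors of index \<open>\<plusminus>k\<close> and closes up the gaps.\<close>

definition coset_rep :: "nat \<Rightarrow> int \<Rightarrow> int \<Rightarrow> int" where
  "coset_rep n k i = (if i \<notin> pm (Suc n) then i else if i = int (Suc n) then k
     else if i = - int (Suc n) then - k else if \<bar>i\<bar> < \<bar>k\<bar> then i else i + sgn i)"

lemma coset_rep_last [simp]:
  "coset_rep n k (int (Suc n)) = k" "coset_rep n k (- int (Suc n)) = - k"
  by (auto simp: coset_rep_def pm_def)

lemma coset_rep_in_pm: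
  "i \<in> pm n \<Longrightarrow> coset_rep n k i = (if \<bar>i\<bar> < \<bar>k\<bar> then i else i + sgn i)"
  by (auto simp: coset_rep_def pm_def)

text \<open>All indices from \<open>\<bar>k\<bar>\<close> on are shifted outwards by one, which
  keeps the order. Hence this factor does not affect inversions inside \<open>pm n\<close>.\<close>

lemma coset_rep_less_iff:
  "i \<in> pm n \<Longrightarrow> j \<in> pm n \<Longrightarrow> coset_rep n k i < coset_rep n k j \<longleftrightarrow> i < j"
  by (auto simp: coset_rep_in_pm pm_def sgn_if)

lemma coset_rep_neg_iff: "i \<in> pm n \<Longrightarrow> coset_rep n k i < 0 \<longleftrightarrow> i < 0"
  by (auto simp: coset_rep_in_pm pm_def sgn_if)

lemma coset_rep_hyperoct:
  assumes "k \<in> pm (Suc n)"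
  shows "coset_rep n k \<in> hyperoct (Suc n)"
proof -
  have "coset_rep n k i \<noteq> k" "coset_rep n k i \<noteq> - k" if "i \<in> pm n" for i
    using that by (auto simp: coset_rep_in_pm pm_def sgn_if)
  moreover have "coset_rep n k i = coset_rep n k j \<longleftrightarrow> i = j" if "i \<in> pm n" "j \<in> pm n" for i j
    using coset_rep_less_iff[OF that] coset_rep_less_iff[OF that(2,1)] by (metis less_irrefl neqE)
  moreover have "k \<noteq> - k"
    using assms by (auto simp: pm_def)
  ultimately have "inj_on (coset_rep n k) (pm (Suc n))"
    unfolding pm_Suc inj_on_def by (auto simp del: of_nat_Suc dest: sym)
  moreover have "coset_rep n k ` pm (Suc n) \<subseteq> pm (Suc n)"
    using assms by (auto simp: coset_rep_def pm_def sgn_if split: if_splits)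
  ultimately have "bij_betw (coset_rep n k) (pm (Suc n)) (pm (Suc n))"
    by (simp add: bij_betw_def endo_inj_surj)
  then have "coset_rep n k permutes pm (Suc n)"
    by (rule bij_imp_permutes) (simp add: coset_rep_def)
  moreover have "coset_rep n k (- i) = - coset_rep n k i" if "i \<in> pm (Suc n)" for i
    using that by (auto simp: coset_rep_def sgn_if)
  ultimately show ?thesis
    by (simp add: hyperoct_def)
qed

lemma coset_rep_image:
  assumes "k \<in> pm (Suc n)"
  shows "coset_rep n k ` pm n = pm (Suc n) - {k, - k}"
proof -
  let ?\<rho> = "coset_rep n k"
  have inj: "inj ?\<rho>"
    using hyperoct_permutes[OF coset_rep_hyperoct[OF assms]] by (rule permutes_inj)
  have "pm n = pm (Suc n) - {int (Suc n), - int (Suc n)}"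
    by (auto simp: pm_def)
  then have "?\<rho> ` pm n = ?\<rho> ` pm (Suc n) - ?\<rho> ` {int (Suc n), - int (Suc n)}"
    by (simp only: image_set_diff[OF inj])
  also have "\<dots> = pm (Suc n) - {k, - k}"
    using permutes_image[OF hyperoct_permutes[OF coset_rep_hyperoct[OF assms]]]
    by (simp del: of_nat_Suc)
  finally show ?thesis .
qed

lemma hyperoct_Suc:
  assumes "\<tau> \<in> hyperoct n"
  shows "\<tau> \<in> hyperoct (Suc n)" "\<tau> (int (Suc n)) = int (Suc n)"
proof -
  have "\<tau> permutes pm (Suc n)"
    using hyperoct_permutes[OF assms] by (rule permutes_subset) (auto simp: pm_def)
  then show "\<tau> \<in> hyperoct (Suc n)"
    by (simp add: hyperoct_def hyperoct_minus[OF assms])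
  show "\<tau> (int (Suc n)) = int (Suc n)"
    using hyperoct_permutes[OF assms] by (rule permutes_not_in) (simp add: pm_def)
qed

text \<open>The image of \<open>n + 1\<close> recovers \<open>k\<close>. Once the representative is
  cancelled, the rest fixes \<open>n + 1\<close> and \<open>- (n + 1)\<close>, so it lies in
  \<open>hyperoct n\<close>.\<close>

lemma bij_betw_cosets:
  "bij_betw (\<lambda>(k, \<tau>). coset_rep n k \<circ> \<tau>) (pm (Suc n) \<times> hyperoct n) (hyperoct (Suc n))"
  unfolding bij_betw_def
proof
  show "inj_on (\<lambda>(k, \<tau>). coset_rep n k \<circ> \<tau>) (pm (Suc n) \<times> hyperoct n)"
  proof (rule inj_onI, clarify)
    fix k \<tau> k' \<tau>'
    assume k: "k \<in> pm (Suc n)" and \<tau>: "\<tau> \<in> hyperoct n" "\<tau>' \<in> hyperoct n"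
      and eq: "coset_rep n k \<circ> \<tau> = coset_rep n k' \<circ> \<tau>'"
    have "k = k'"
      using fun_cong[OF eq, of "int (Suc n)"] by (simp add: hyperoct_Suc(2)[OF \<tau>(1)] hyperoct_Suc(2)[OF \<tau>(2)] del: of_nat_Suc)
    moreover from this have "\<tau> i = \<tau>' i" for i
      using fun_cong[OF eq, of i] hyperoct_inj[OF coset_rep_hyperoct[OF k]] by simp
    ultimately show "k = k' \<and> \<tau> = \<tau>'"
      by auto
  qed
  show "(\<lambda>(k, \<tau>). coset_rep n k \<circ> \<tau>) ` (pm (Suc n) \<times> hyperoct n) = hyperoct (Suc n)"
  proof (intro equalityI subsetI)
    fix \<sigma> assume \<sigma>: "\<sigma> \<in> hyperoct (Suc n)"
    let ?k = "\<sigma> (int (Suc n))"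
    have k: "?k \<in> pm (Suc n)"
      using hyperoct_in_pm[OF \<sigma>] by (auto simp: pm_def)
    note \<rho> = coset_rep_hyperoct[OF k]
    define \<tau> where "\<tau> = inv (coset_rep n ?k) \<circ> \<sigma>"
    have \<tau>: "\<tau> \<in> hyperoct (Suc n)"
      unfolding \<tau>_def by (intro hyperoct_comp hyperoct_inv \<rho> \<sigma>)
    have last: "\<tau> (int (Suc n)) = int (Suc n)"
      using hyperoct_inv_apply(1)[OF \<rho>, of "int (Suc n)"] by (simp add: \<tau>_def del: of_nat_Suc)
    have "\<tau> permutes pm n"
      using hyperoct_permutes[OF \<tau>]
    proof (rule permutes_superset)
      show "\<And>i. i \<in> pm (Suc n) - pm n \<Longrightarrow> \<tau> i = i"
        using last hyperoct_minus[OF \<tau>, of "int (Suc n)"] by (auto simp: pm_Suc simp del: of_nat_Suc)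
    qed
    then have "\<tau> \<in> hyperoct n"
      by (simp add: hyperoct_def hyperoct_minus[OF \<tau>])
    moreover have "\<sigma> = coset_rep n ?k \<circ> \<tau>"
      by (simp add: fun_eq_iff \<tau>_def hyperoct_inv_apply(2)[OF \<rho>] del: of_nat_Suc)
    ultimately show "\<sigma> \<in> (\<lambda>(k, \<tau>). coset_rep n k \<circ> \<tau>) ` (pm (Suc n) \<times> hyperoct n)"
      using k by (intro image_eqI[of _ _ "(?k, \<tau>)"]) auto
  qed (auto intro: hyperoct_comp coset_rep_hyperoct hyperoct_Suc)
qed

text \<open>The representative keeps sign and order on \<open>pm n\<close>, so only the position
  \<open>n + 1\<close>, with value \<open>k\<close>, adds anything. Its inversions are the values
  above \<open>k\<close> taken on \<open>pm n\<close>, and these values are all of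
  \<open>pm (Suc n)\<close> except \<open>k\<close> and \<open>- k\<close>.\<close>

lemma coset_length:
  assumes k: "k \<in> pm (Suc n)" and \<tau>: "\<tau> \<in> hyperoct n"
  shows "l1 (Suc n) (coset_rep n k \<circ> \<tau>) = of_bool (k < 0) + l1 n \<tau>"
    and "l2 (Suc n) (coset_rep n k \<circ> \<tau>) = card {i \<in> pm (Suc n) - {k, - k}. k < i} + l2 n \<tau>"
proof -
  let ?\<rho> = "coset_rep n k" and ?m = "int (Suc n)"
  have \<sigma>: "?\<rho> \<circ> \<tau> \<in> hyperoct (Suc n)"
    by (intro hyperoct_comp coset_rep_hyperoct k hyperoct_Suc \<tau>)
  have m: "\<tau> ?m = ?m"
    by (rule hyperoct_Suc(2)[OF \<tau>])
  have in_pm: "\<tau> i \<in> pm n" if "i \<in> pm n" for i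
    using that hyperoct_in_pm[OF \<tau>] by blast
  have pos: "j \<in> pm n" if "0 < j" "j \<le> int n" for j
    using that by (auto simp: pm_def)
  have "neg_set (Suc n) (?\<rho> \<circ> \<tau>) = (if k < 0 then insert ?m (neg_set n \<tau>) else neg_set n \<tau>)"
  proof (intro set_eqI)
    fix j
    consider "j = ?m" | "0 < j" "j \<le> int n" | "j \<le> 0 \<or> ?m < j"
      by fastforce
    then show "j \<in> neg_set (Suc n) (?\<rho> \<circ> \<tau>) \<longleftrightarrow>
        j \<in> (if k < 0 then insert ?m (neg_set n \<tau>) else neg_set n \<tau>)"
    proof cases
      case 1
      then show ?thesis
        using m by (auto simp: neg_set_def simp del: of_nat_Suc)
    next
      case 2
      then show ?thesis
        using coset_rep_neg_iff[OF in_pm[OF pos[OF 2]]] by (auto simp: neg_set_def)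
    qed (auto simp: neg_set_def)
  qed
  moreover have "?m \<notin> neg_set n \<tau>"
    by (simp add: neg_set_def)
  ultimately show "l1 (Suc n) (?\<rho> \<circ> \<tau>) = of_bool (k < 0) + l1 n \<tau>"
    by (simp add: l1_l2_eq[OF \<sigma>] l1_l2_eq[OF \<tau>] del: of_nat_Suc)
  let ?A = "{i \<in> pm n. k < ?\<rho> (\<tau> i)}"
  have "inv_set (Suc n) (?\<rho> \<circ> \<tau>) = inv_set n \<tau> \<union> (\<lambda>i. (i, ?m)) ` ?A"
  proof (intro set_eqI, clarify)
    fix i j
    consider "j = ?m" | "i \<in> pm n" "\<bar>i\<bar> < j" "j \<le> int n" | "i \<notin> pm (Suc n) \<or> \<not> \<bar>i\<bar> < j \<or> ?m < j"
      by (fastforce simp: pm_def)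
    then show "(i, j) \<in> inv_set (Suc n) (?\<rho> \<circ> \<tau>) \<longleftrightarrow> (i, j) \<in> inv_set n \<tau> \<union> (\<lambda>i. (i, ?m)) ` ?A"
    proof cases
      case 1
      have "i \<in> pm (Suc n) \<and> \<bar>i\<bar> < ?m \<longleftrightarrow> i \<in> pm n"
        by (auto simp: pm_def)
      then show ?thesis
        using m 1 by (auto simp: inv_set_def simp del: of_nat_Suc)
    next
      case 2
      then have "j \<in> pm n" "i \<in> pm (Suc n)" "j \<noteq> ?m"
        by (auto simp: pm_def)
      then show ?thesis
        using 2 coset_rep_less_iff[OF in_pm[of j] in_pm[of i]] by (auto simp: inv_set_def)
    qed (auto simp: inv_set_def pm_def)
  qed
  moreover have "inv_set n \<tau> \<inter> (\<lambda>i. (i, ?m)) ` ?A = {}"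
    by (auto simp: inv_set_def)
  moreover have "card ((\<lambda>i. (i, ?m)) ` ?A) = card {i \<in> pm (Suc n) - {k, - k}. k < i}"
  proof -
    have "{i \<in> pm (Suc n) - {k, - k}. k < i} = (?\<rho> \<circ> \<tau>) ` ?A"
    proof -
      have "(?\<rho> \<circ> \<tau>) ` pm n = pm (Suc n) - {k, - k}"
        using coset_rep_image[OF k] permutes_image[OF hyperoct_permutes[OF \<tau>]]
        unfolding image_comp[symmetric] by simp
      then show ?thesis
        by (auto simp flip: Collect_conj_eq)
    qed
    moreover have "inj_on (?\<rho> \<circ> \<tau>) ?A"
      using permutes_inj[OF hyperoct_permutes[OF \<sigma>]] by (rule inj_on_subset) simp
    ultimately show ?thesis
      by (simp add: card_image inj_on_def)
  qed
  ultimately show "l2 (Suc n) (?\<rho> \<circ> \<tau>) = card {i \<in> pm (Suc n) - {k, - k}. k < i} + l2 n \<tau>"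
    by (simp add: l1_l2_eq[OF \<sigma>] l1_l2_eq[OF \<tau>] card_Un_disjoint)
qed

text \<open>The set is a parameter because the weight is used for tensor positions, with
  \<open>pm (Suc n)\<close>, and later for sets of original indices.\<close>

definition del_weight :: "real \<Rightarrow> real \<Rightarrow> int set \<Rightarrow> int \<Rightarrow> real" where
  "del_weight \<alpha> q S a = (if a < 0 then \<alpha> else 1) * q ^ card {t \<in> S - {a, - a}. a < t}"

lemma Pn_apply:
  "Pn \<alpha> q n f y = (\<Sum>\<sigma>\<in>hyperoct n. complex_of_real (\<alpha> ^ l1 n \<sigma> * q ^ l2 n \<sigma>) * f (y \<circ> \<sigma>))"
  unfolding Pn_def sum_tensor_apply by (simp add: tscale_def act_def)

text \<open>The inner sum is the deformation of level \<open>n\<close> acting on the inner factors;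
  the outer sum will become the sum over the deleted index in \<open>annih\<close>.\<close>

lemma Pn_Suc_apply:
  "Pn \<alpha> q (Suc n) f y = (\<Sum>k\<in>pm (Suc n). complex_of_real (del_weight \<alpha> q (pm (Suc n)) k) *
     (\<Sum>\<tau>\<in>hyperoct n. complex_of_real (\<alpha> ^ l1 n \<tau> * q ^ l2 n \<tau>) * f (y \<circ> coset_rep n k \<circ> \<tau>)))"
proof -
  have "Pn \<alpha> q (Suc n) f y = (\<Sum>(k, \<tau>)\<in>pm (Suc n) \<times> hyperoct n. complex_of_real
      (\<alpha> ^ l1 (Suc n) (coset_rep n k \<circ> \<tau>) * q ^ l2 (Suc n) (coset_rep n k \<circ> \<tau>)) *
      f (y \<circ> (coset_rep n k \<circ> \<tau>)))"
    unfolding Pn_apply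
    by (subst sum.reindex_bij_betw[OF bij_betw_cosets, symmetric]) (simp add: case_prod_unfold)
  also have "\<dots> = (\<Sum>(k, \<tau>)\<in>pm (Suc n) \<times> hyperoct n.
      complex_of_real (del_weight \<alpha> q (pm (Suc n)) k) *
      (complex_of_real (\<alpha> ^ l1 n \<tau> * q ^ l2 n \<tau>) * f (y \<circ> coset_rep n k \<circ> \<tau>)))"
    by (intro sum.cong) (auto simp: coset_length del_weight_def power_add comp_assoc mult_ac)
  also have "\<dots> = (\<Sum>k\<in>pm (Suc n). complex_of_real (del_weight \<alpha> q (pm (Suc n)) k) *
     (\<Sum>\<tau>\<in>hyperoct n. complex_of_real (\<alpha> ^ l1 n \<tau> * q ^ l2 n \<tau>) * f (y \<circ> coset_rep n k \<circ> \<tau>)))"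
    by (simp add: sum.cartesian_product[symmetric] sum_distrib_left)
  finally show ?thesis .
qed


section \<open>The adjoint of the creation operator\<close>

text \<open>Tensors are themselves functions, so the simplifier would otherwise unfold their sums pointwise
  wherever they occur eta-expanded.\<close>

declare plus_fun_apply [simp del] zero_fun_apply [simp del]

section \<open>Linearity and adjoints on the algebraic tensor powers\<close>

lemma K_zero: "0 \<in> K n"
  unfolding K_def by (rule tensor.span_zero)

lemma K_add: "f \<in> K n \<Longrightarrow> g \<in> K n \<Longrightarrow> f + g \<in> K n"
  unfolding K_def by (rule tensor.span_add)

lemma K_scale: "f \<in> K n \<Longrightarrow> tscale c f \<in> K n"
  unfolding K_def by (rule tensor.span_scale)

lemma K_sum: "(\<And>i. i \<in> I \<Longrightarrow> f i \<in> K n) \<Longrightarrow> (\<Sum>i\<in>I. f i) \<in> K n"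
  unfolding K_def by (rule tensor.span_sum)

lemma K_induct [consumes 1, case_names zero step]:
  assumes "f \<in> K n" "P 0"
    and "\<And>c u g. g \<in> K n \<Longrightarrow> P g \<Longrightarrow> P (tscale c (tens n u) + g)"
  shows "P f"
proof -
  have "f \<in> K n \<and> P f"
    using assms(1) unfolding K_def
  proof (induction rule: tensor.span_induct_alt)
    case base
    then show ?case
      using assms(2) K_zero by (simp add: K_def)
  next
    case (step c h g)
    then show ?case
      using assms(3)[of g c] unfolding K_def
      by (auto intro: tensor.span_add tensor.span_scale tensor.span_base)
  qed
  then show ?thesis
    by blast
qed

lemma tens_linear_K:
  assumes "f \<in> K n" "L 0 = 0" "\<And>c g h. L (tscale c g + h) = tscale c (L g) + L h"
    and "\<And>u. L (tens n u) \<in> K m"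
  shows "L f \<in> K m"
  using assms(1) by (induction rule: K_induct) (simp_all add: assms K_zero K_add K_scale)

lemma tinner_zero_left: "g \<in> K n \<Longrightarrow> tinner n 0 g = 0"
  using tinner_eq[of "{}" 0 "\<lambda>_. 0" n g] by simp

lemma tinner_zero_right: "f \<in> K n \<Longrightarrow> tinner n f 0 = 0"
  using tinner_commute[OF K_zero, of f n] by (simp add: tinner_zero_left)

lemma tinner_tens_left: "g \<in> K n \<Longrightarrow> tinner n (tens n u) g = g u"
  using tinner_eq[of "{u}" "tens n u" "\<lambda>_. 1" n g] by (simp add: tscale_def)

lemma tinner_add_left:
  assumes "f \<in> K n" "g \<in> K n" "h \<in> K n"
  shows "tinner n (f + g) h = tinner n f h + tinner n g h"
proof -
  have "tinner n (f + g) h = cnj (tinner n h (f + g))"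
    using assms by (intro tinner_commute K_add)
  then show ?thesis
    using assms tinner_commute[of h n] by (simp add: tinner_add_right)
qed

lemma tinner_scale_left:
  assumes "f \<in> K n" "g \<in> K n"
  shows "tinner n (tscale c f) g = cnj c * tinner n f g"
proof -
  have "tinner n (tscale c f) g = cnj (tinner n g (tscale c f))"
    using assms by (intro tinner_commute K_scale)
  then show ?thesis
    using assms tinner_commute[of g n] by (simp add: tinner_scale_right)
qed

lemma tinner_lincomb_left:
  assumes "finite I" "g \<in> K n"
  shows "tinner n (\<Sum>i\<in>I. tscale (c i) (tens n (v i))) g = (\<Sum>i\<in>I. cnj (c i) * g (v i))"
  using assms(1)
proof (induction rule: finite_induct)
  case (insert i I)
  then show ?case
    using assms(2)
    by (simp add: tinner_add_left tinner_scale_left tinner_tens_left K_scale K_sum tens_in_K)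
qed (simp add: tinner_zero_left assms(2))

text \<open>Pairing with \<open>tens n u\<close> on the left evaluates a functional at
  \<open>u\<close>. On elementary tensors adjointness is therefore a pointwise identity for
  \<open>h\<close>, and linearity does the rest.\<close>

lemma tinner_adjointI:
  assumes "f \<in> K n" "g \<in> K m" "h \<in> K n"
    and L: "L 0 = 0" "\<And>c g h. L (tscale c g + h) = tscale c (L g) + L h"
    and tens: "\<And>u. L (tens n u) \<in> K m" "\<And>u. tinner m (L (tens n u)) g = h u"
  shows "tinner m (L f) g = tinner n f h"
  using assms(1)
proof (induction rule: K_induct)
  case zero
  then show ?case
    using assms by (simp add: tinner_zero_left)
next
  case (step c u f)
  have "L f \<in> K m"
    using step(1) L tens(1) by (rule tens_linear_K)
  then show ?case
    using step assms(2,3) tens(1)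
    by (simp add: L(2) tens(2) tinner_add_left tinner_scale_left tinner_tens_left K_scale tens_in_K)
qed

lemma Pn_zero: "Pn \<alpha> q n 0 = 0"
  by (simp add: zero_fun_apply fun_eq_iff Pn_apply)

lemma Pn_linear: "Pn \<alpha> q n (tscale c f + g) = tscale c (Pn \<alpha> q n f) + Pn \<alpha> q n g"
  by (simp add: plus_fun_apply fun_eq_iff Pn_apply tscale_def algebra_simps sum.distrib sum_distrib_left)

text \<open>\<open>act\<close> produces \<open>inv \<sigma>\<close>; reindexing by inversion removes
  it, since the weights are invariant. The coefficients then agree with those of
  \<open>Pn_apply\<close>, which makes the deformation self-adjoint.\<close>

lemma Pn_tens:
  "Pn \<alpha> q n (tens n u) =
    (\<Sum>\<sigma>\<in>hyperoct n. tscale (complex_of_real (\<alpha> ^ l1 n \<sigma> * q ^ l2 n \<sigma>)) (tens n (u \<circ> \<sigma>)))"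
proof -
  have bij: "bij_betw inv (hyperoct n) (hyperoct n)"
    by (rule bij_betw_byWitness[where f' = inv])
      (use permutes_inv_inv[OF hyperoct_permutes] hyperoct_inv in blast)+
  have "Pn \<alpha> q n (tens n u) =
      (\<Sum>\<sigma>\<in>hyperoct n. tscale (complex_of_real (\<alpha> ^ l1 n (inv \<sigma>) * q ^ l2 n (inv \<sigma>)))
        (tens n (u \<circ> inv \<sigma>)))"
    unfolding Pn_def by (intro sum.cong refl) (simp add: act_tens l1_l2_inv)
  then show ?thesis
    by (simp only: sum.reindex_bij_betw[OF bij, of
      "\<lambda>\<sigma>. tscale (complex_of_real (\<alpha> ^ l1 n \<sigma> * q ^ l2 n \<sigma>)) (tens n (u \<circ> \<sigma>))"])
qed

lemma Pn_K:
  assumes "f \<in> K n"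
  shows "Pn \<alpha> q n f \<in> K n"
proof (rule tens_linear_K[OF assms Pn_zero Pn_linear])
  show "Pn \<alpha> q n (tens n u) \<in> K n" for u
    unfolding Pn_tens by (intro K_sum K_scale tens_in_K)
qed

lemma tinner_Pn:
  assumes "f \<in> K n" "g \<in> K n"
  shows "tinner n (Pn \<alpha> q n f) g = tinner n f (Pn \<alpha> q n g)"
proof (rule tinner_adjointI[OF assms Pn_K[OF assms(2)] Pn_zero Pn_linear])
  show "Pn \<alpha> q n (tens n u) \<in> K n" for u
    by (rule Pn_K[OF tens_in_K])
  show "tinner n (Pn \<alpha> q n (tens n u)) g = Pn \<alpha> q n g u" for u
    unfolding Pn_tens Pn_apply using assms(2) by (simp add: tinner_lincomb_left)
qed

section \<open>Creation and annihilation at a fixed level\<close>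

definition create :: "nat \<Rightarrow> 'a::real_inner cplx \<Rightarrow> 'a cplx \<Rightarrow> 'a tensor \<Rightarrow> 'a tensor" where
  "create n x y f =
    (\<lambda>z. cinner (z (- int (Suc n))) x * f z * cinner (z (int (Suc n))) y)"

text \<open>The argument passed to \<open>f\<close> has \<open>x\<close> at \<open>- k\<close>,
  \<open>y\<close> at \<open>k\<close> and the entries of \<open>z\<close> in order elsewhere, so
  each summand contracts two factors. In this form independence of a representation by elementary
  tensors is automatic.\<close>

definition annih :: "real \<Rightarrow> real \<Rightarrow> nat \<Rightarrow> 'a::real_inner cplx \<Rightarrow> 'a cplx \<Rightarrow> 'a tensor \<Rightarrow> 'a tensor"
  where
  "annih \<alpha> q n x y f = (\<lambda>z. \<Sum>k\<in>pm (Suc n). complex_of_real (del_weight \<alpha> q (pm (Suc n)) k) *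
     f (z(- int (Suc n) := x, int (Suc n) := y) \<circ> inv (coset_rep n k)))"

lemma bstar_0 [simp]: "bstar x y f 0 = 0"
  and bstar_Suc [simp]: "bstar x y f (Suc n) = create n x y (f n)"
  by (simp_all add: bstar_def create_def)

lemma create_zero: "create n x y 0 = 0"
  by (simp add: create_def fun_eq_iff zero_fun_apply)

lemma create_linear: "create n x y (tscale c f + g) = tscale c (create n x y f) + create n x y g"
  by (simp add: plus_fun_apply create_def fun_eq_iff tscale_def algebra_simps)

lemma create_tens:
  "create n x y (tens n z) = tens (Suc n) (z(- int (Suc n) := x, int (Suc n) := y))"
  using bstar_tens[of "\<lambda>_. tens n z" n z x y] by simp

lemma create_K:
  assumes "f \<in> K n"
  shows "create n x y f \<in> K (Suc n)"
proof (rule tens_linear_K[OF assms create_zero create_linear])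
  show "create n x y (tens n u) \<in> K (Suc n)" for u
    unfolding create_tens by (rule tens_in_K)
qed

lemma annih_zero: "annih \<alpha> q n x y 0 = 0"
  by (simp add: annih_def fun_eq_iff zero_fun_apply)

lemma annih_linear: "annih \<alpha> q n x y (tscale c f + g) =
    tscale c (annih \<alpha> q n x y f) + annih \<alpha> q n x y g"
  by (simp add: plus_fun_apply annih_def fun_eq_iff tscale_def algebra_simps sum.distrib sum_distrib_left)

lemma tens_Suc:
  "tens (Suc n) v z = cinner (z (- int (Suc n))) (v (- int (Suc n))) *
    (cinner (z (int (Suc n))) (v (int (Suc n))) * tens n v z)"
proof -
  have "- int (Suc n) \<notin> insert (int (Suc n)) (pm n)" "int (Suc n) \<notin> pm n"
    by (auto simp: pm_def)
  then show ?thesis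
    by (simp add: tens_def pm_Suc del: of_nat_Suc)
qed

lemma annih_tens:
  "annih \<alpha> q n x y (tens (Suc n) u) = (\<Sum>k\<in>pm (Suc n).
     tscale (complex_of_real (del_weight \<alpha> q (pm (Suc n)) k) * cinner x (u (- k)) * cinner y (u k))
       (tens n (u \<circ> coset_rep n k)))"
proof
  fix z :: "int \<Rightarrow> 'a cplx"
  let ?z = "z(- int (Suc n) := x, int (Suc n) := y)"
  have "tens (Suc n) u (?z \<circ> inv (coset_rep n k)) =
      cinner x (u (- k)) * cinner y (u k) * tens n (u \<circ> coset_rep n k) z"
    if k: "k \<in> pm (Suc n)" for k
  proof -
    note \<rho> = coset_rep_hyperoct[OF k]
    have "tens (Suc n) u (?z \<circ> inv (coset_rep n k)) = tens (Suc n) (u \<circ> coset_rep n k) ?z"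
      using fun_cong[OF act_tens[OF hyperoct_inv[OF \<rho>], of u], of ?z]
      by (simp add: act_def permutes_inv_inv[OF hyperoct_permutes[OF \<rho>]] del: of_nat_Suc)
    also have "\<dots> = cinner x (u (- k)) * (cinner y (u k) * tens n (u \<circ> coset_rep n k) ?z)"
      unfolding tens_Suc by (simp del: of_nat_Suc)
    also have "tens n (u \<circ> coset_rep n k) ?z = tens n (u \<circ> coset_rep n k) z"
      unfolding tens_def by (intro prod.cong) (auto simp: pm_def)
    finally show ?thesis
      by (simp only: mult.assoc)
  qed
  then show "annih \<alpha> q n x y (tens (Suc n) u) z = (\<Sum>k\<in>pm (Suc n).
     tscale (complex_of_real (del_weight \<alpha> q (pm (Suc n)) k) * cinner x (u (- k)) * cinner y (u k))
       (tens n (u \<circ> coset_rep n k))) z"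
    unfolding annih_def sum_tensor_apply by (intro sum.cong refl) (simp add: tscale_def)
qed

lemma annih_K:
  assumes "f \<in> K (Suc n)"
  shows "annih \<alpha> q n x y f \<in> K n"
proof (rule tens_linear_K[OF assms annih_zero annih_linear])
  show "annih \<alpha> q n x y (tens (Suc n) u) \<in> K n" for u
    unfolding annih_tens by (intro K_sum K_scale tens_in_K)
qed

text \<open>For elementary \<open>f\<close> both sides are the same double sum over \<open>k\<close>
  and \<open>\<tau>\<close>: each \<open>\<tau>\<close> fixes \<open>n + 1\<close> and
  \<open>- (n + 1)\<close>, so the outer factors of \<open>create\<close> see only
  \<open>u k\<close> and \<open>u (- k)\<close>.\<close>

lemma tinner_annih:
  assumes "f \<in> K (Suc n)" "g \<in> K n"
  shows "tinner n (annih \<alpha> q n x y f) (Pn \<alpha> q n g) =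
    tinner (Suc n) f (Pn \<alpha> q (Suc n) (create n x y g))"
proof (rule tinner_adjointI[OF assms(1) Pn_K[OF assms(2)] Pn_K[OF create_K[OF assms(2)]]
      annih_zero annih_linear])
  show "annih \<alpha> q n x y (tens (Suc n) u) \<in> K n" for u
    by (rule annih_K[OF tens_in_K])
  fix u :: "int \<Rightarrow> 'a cplx"
  have \<tau>: "\<tau> (int (Suc n)) = int (Suc n)" "\<tau> (- int (Suc n)) = - int (Suc n)"
    if "\<tau> \<in> hyperoct n" for \<tau>
    using that hyperoct_Suc(2) hyperoct_minus by metis+
  show "tinner n (annih \<alpha> q n x y (tens (Suc n) u)) (Pn \<alpha> q n g) =
      Pn \<alpha> q (Suc n) (create n x y g) u"
    unfolding annih_tens Pn_Suc_apply tinner_lincomb_left[OF finite_pm Pn_K[OF assms(2)]]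
    by (intro sum.cong refl)
      (simp add: Pn_apply create_def \<tau> sum_distrib_left cinner_commute[of x] cinner_commute[of y]
        mult_ac del: of_nat_Suc)
qed

section \<open>Finitely supported vectors and the deformed inner product\<close>

lemma F_finD: "f \<in> F_fin \<Longrightarrow> f n \<in> K n"
  by (simp add: F_fin_def)

lemma F_fin_bound:
  assumes "f \<in> F_fin"
  obtains N where "\<And>n. n \<ge> N \<Longrightarrow> f n = 0"
proof -
  obtain N where "{n. f n \<noteq> 0} \<subseteq> {..<N}"
    using assms finite_nat_bounded[of "{n. f n \<noteq> 0}"] unfolding F_fin_def by blast
  then show ?thesis
    by (intro that[of N]) (auto simp: not_less[symmetric])
qed

lemma F_finI:
  assumes "\<And>n. f n \<in> K n" "\<And>n. n \<ge> N \<Longrightarrow> f n = 0"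
  shows "f \<in> F_fin"
proof -
  have "{n. f n \<noteq> 0} \<subseteq> {..<N}"
    using assms(2) by (auto simp: not_le[symmetric])
  then show ?thesis
    using assms(1) by (simp add: F_fin_def finite_subset)
qed

lemma F_fin_add:
  assumes "f \<in> F_fin" "g \<in> F_fin"
  shows "f + g \<in> F_fin"
proof -
  obtain N M where "\<And>n. n \<ge> N \<Longrightarrow> f n = 0" "\<And>n. n \<ge> M \<Longrightarrow> g n = 0"
    using assms F_fin_bound by metis
  then show ?thesis
    using assms by (intro F_finI[of _ "max N M"]) (auto simp: plus_fun_apply K_add F_finD)
qed

lemma vacuum_F_fin: "vacuum \<in> F_fin"
  by (rule F_finI[of _ 1]) (auto simp: vacuum_def tens_in_K K_zero)

lemma bstar_F_fin:
  assumes "f \<in> F_fin"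
  shows "bstar x y f \<in> F_fin"
proof -
  obtain N where N: "\<And>n. n \<ge> N \<Longrightarrow> f n = 0"
    using F_fin_bound[OF assms] by blast
  show ?thesis
  proof (rule F_finI[of _ "Suc N"])
    show "bstar x y f n \<in> K n" for n
      using F_finD[OF assms] by (cases n) (simp_all add: K_zero create_K)
    show "bstar x y f n = 0" if "n \<ge> Suc N" for n
      using N that by (cases n) (simp_all add: create_zero)
  qed
qed

text \<open>The explicit adjoint of \<open>bstar\<close>, which serves as witness for the choice in
  \<open>dadjoint\<close>.\<close>

definition bsub :: "real \<Rightarrow> real \<Rightarrow> 'a::real_inner cplx \<Rightarrow> 'a cplx \<Rightarrow> 'a fock \<Rightarrow> 'a fock" where
  "bsub \<alpha> q x y f = (\<lambda>n. annih \<alpha> q n x y (f (Suc n)))"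

lemma bsub_F_fin:
  assumes "f \<in> F_fin"
  shows "bsub \<alpha> q x y f \<in> F_fin"
proof -
  obtain N where N: "\<And>n. n \<ge> N \<Longrightarrow> f n = 0"
    using F_fin_bound[OF assms] by blast
  show ?thesis
    using F_finD[OF assms] N by (intro F_finI[of _ N]) (simp_all add: bsub_def annih_zero annih_K)
qed

text \<open>\<open>inner00\<close> sums over the support of its left argument; a common range makes
  sums with different supports comparable.\<close>

lemma dinner_eq_sum:
  assumes "f \<in> F_fin" "g \<in> F_fin" "\<And>n. n \<ge> N \<Longrightarrow> f n = 0"
  shows "dinner \<alpha> q f g = (\<Sum>n<N. tinner n (f n) (Pn \<alpha> q n (g n)))"
  unfolding dinner_def inner00_def
proof (rule sum.mono_neutral_left)
  show "{n. f n \<noteq> 0} \<subseteq> {..<N}"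
    using assms(3) by (auto simp: not_le[symmetric])
  show "\<forall>n\<in>{..<N} - {n. f n \<noteq> 0}. tinner n (f n) (Pn \<alpha> q n (g n)) = 0"
    using assms(2) by (auto simp: tinner_zero_left Pn_K F_finD)
qed simp

lemma dinner_add_left:
  assumes "f \<in> F_fin" "g \<in> F_fin" "h \<in> F_fin"
  shows "dinner \<alpha> q (f + g) h = dinner \<alpha> q f h + dinner \<alpha> q g h"
proof -
  obtain N M where "\<And>n. n \<ge> N \<Longrightarrow> f n = 0" "\<And>n. n \<ge> M \<Longrightarrow> g n = 0"
    using assms F_fin_bound by metis
  then show ?thesis
    using assms
    by (simp add: dinner_eq_sum[of _ _ "max N M"] plus_fun_apply F_fin_add tinner_add_left F_finD Pn_K sum.distrib)
qed

lemma dinner_commute: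
  assumes "f \<in> F_fin" "g \<in> F_fin"
  shows "dinner \<alpha> q g f = cnj (dinner \<alpha> q f g)"
proof -
  obtain N M where "\<And>n. n \<ge> N \<Longrightarrow> f n = 0" "\<And>n. n \<ge> M \<Longrightarrow> g n = 0"
    using assms F_fin_bound by metis
  moreover have "tinner n (g n) (Pn \<alpha> q n (f n)) = cnj (tinner n (f n) (Pn \<alpha> q n (g n)))" for n
    using assms tinner_commute[of "Pn \<alpha> q n (f n)" n "g n"]
    by (simp add: F_finD Pn_K tinner_Pn)
  ultimately show ?thesis
    using assms by (simp add: dinner_eq_sum[of _ _ "max N M"])
qed

lemma dinner_add_right:
  assumes "f \<in> F_fin" "g \<in> F_fin" "h \<in> F_fin"
  shows "dinner \<alpha> q f (g + h) = dinner \<alpha> q f g + dinner \<alpha> q f h"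
  unfolding dinner_commute[OF F_fin_add[OF assms(2,3)] assms(1)] dinner_commute[OF assms(2,1)]
    dinner_commute[OF assms(3,1)] dinner_add_left[OF assms(2,3,1)] by simp

lemma dinner_bsub:
  assumes "f \<in> F_fin" "g \<in> F_fin"
  shows "dinner \<alpha> q (bsub \<alpha> q x y f) g = dinner \<alpha> q f (bstar x y g)"
proof -
  obtain N where N: "\<And>n. n \<ge> N \<Longrightarrow> f n = 0"
    using F_fin_bound[OF assms(1)] by blast
  have "dinner \<alpha> q (bsub \<alpha> q x y f) g = (\<Sum>n<N. tinner n (bsub \<alpha> q x y f n) (Pn \<alpha> q n (g n)))"
    using assms N by (intro dinner_eq_sum bsub_F_fin) (simp_all add: bsub_def annih_zero)
  also have "\<dots> = (\<Sum>n<N. tinner (Suc n) (f (Suc n)) (Pn \<alpha> q (Suc n) (bstar x y g (Suc n))))"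
    using assms by (simp add: bsub_def tinner_annih F_finD)
  \<comment> \<open>The added term \<open>n = 0\<close> vanishes because \<open>bstar\<close> has no
    component of level 0.\<close>
  also have "\<dots> = (\<Sum>n<Suc N. tinner n (f n) (Pn \<alpha> q n (bstar x y g n)))"
    unfolding sum.lessThan_Suc_shift using F_finD[OF assms(1)]
    by (simp add: Pn_zero tinner_zero_right)
  also have "\<dots> = dinner \<alpha> q f (bstar x y g)"
    using assms N by (intro dinner_eq_sum[symmetric] bstar_F_fin) simp_all
  finally show ?thesis .
qed

lemma
  assumes "f \<in> F_fin"
  shows bann_F_fin: "bann \<alpha> q x y f \<in> F_fin"
    and dinner_bann: "g \<in> F_fin \<Longrightarrow> dinner \<alpha> q (bann \<alpha> q x y f) g = dinner \<alpha> q f (bstar x y g)"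
proof -
  have "(\<forall>f\<in>F_fin. bann \<alpha> q x y f \<in> F_fin) \<and> (\<forall>f\<in>F_fin. \<forall>g\<in>F_fin.
      dinner \<alpha> q (bann \<alpha> q x y f) g = dinner \<alpha> q f (bstar x y g))"
    unfolding bann_def dadjoint_def
    by (rule someI[of _ "bsub \<alpha> q x y"]) (simp add: bsub_F_fin dinner_bsub)
  then show "bann \<alpha> q x y f \<in> F_fin"
    and "g \<in> F_fin \<Longrightarrow> dinner \<alpha> q (bann \<alpha> q x y f) g = dinner \<alpha> q f (bstar x y g)"
    using assms by blast+
qed

section \<open>Replacing the Gaussian operators by explicit ones\<close>

definition gauss :: "real \<Rightarrow> real \<Rightarrow> 'a::real_inner \<Rightarrow> 'a \<Rightarrow> 'a fock \<Rightarrow> 'a fock" where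
  "gauss \<alpha> q x y f = bsub \<alpha> q (cplx_of x) (cplx_of y) f + bstar (cplx_of x) (cplx_of y) f"

lemma gauss_F_fin: "f \<in> F_fin \<Longrightarrow> gauss \<alpha> q x y f \<in> F_fin"
  by (simp add: gauss_def F_fin_add bsub_F_fin bstar_F_fin)

lemma Gauss_F_fin: "f \<in> F_fin \<Longrightarrow> Gauss \<alpha> q x y f \<in> F_fin"
  unfolding Gauss_def by (simp add: F_fin_add bann_F_fin bstar_F_fin)

text \<open>Both \<open>bann\<close> and \<open>bsub\<close> are adjoint to \<open>bstar\<close>, so either way the left-hand side is the
  same functional of \<open>f\<close> and \<open>g\<close>. This replaces the uniqueness of the adjoint, hence the strict
  positivity of the deformed inner product.\<close>

lemma dinner_Gauss:
  assumes "f \<in> F_fin" "g \<in> F_fin"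
  shows "dinner \<alpha> q (Gauss \<alpha> q x y f) g = dinner \<alpha> q f (gauss \<alpha> q x y g)"
    and "dinner \<alpha> q (gauss \<alpha> q x y f) g = dinner \<alpha> q f (gauss \<alpha> q x y g)"
proof -
  let ?x = "cplx_of x" and ?y = "cplx_of y"
  have bstar: "dinner \<alpha> q (bstar ?x ?y f) g = dinner \<alpha> q f (bsub \<alpha> q ?x ?y g)"
  proof -
    have "dinner \<alpha> q (bstar ?x ?y f) g = cnj (dinner \<alpha> q g (bstar ?x ?y f))"
      by (rule dinner_commute[OF assms(2) bstar_F_fin[OF assms(1)]])
    also have "\<dots> = cnj (dinner \<alpha> q (bsub \<alpha> q ?x ?y g) f)"
      by (simp only: dinner_bsub[OF assms(2,1)])
    also have "\<dots> = dinner \<alpha> q f (bsub \<alpha> q ?x ?y g)"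
      by (rule dinner_commute[OF bsub_F_fin[OF assms(2)] assms(1), symmetric])
    finally show ?thesis .
  qed
  have add: "dinner \<alpha> q f (bsub \<alpha> q ?x ?y g + bstar ?x ?y g) =
      dinner \<alpha> q f (bsub \<alpha> q ?x ?y g) + dinner \<alpha> q f (bstar ?x ?y g)"
    by (rule dinner_add_right[OF assms(1) bsub_F_fin[OF assms(2)] bstar_F_fin[OF assms(2)]])
  show "dinner \<alpha> q (Gauss \<alpha> q x y f) g = dinner \<alpha> q f (gauss \<alpha> q x y g)"
    unfolding Gauss_def gauss_def add
      dinner_add_left[OF bann_F_fin[OF assms(1)] bstar_F_fin[OF assms(1)] assms(2)]
      dinner_bann[OF assms] bstar by (rule add.commute)
  show "dinner \<alpha> q (gauss \<alpha> q x y f) g = dinner \<alpha> q f (gauss \<alpha> q x y g)"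
    unfolding gauss_def add
      dinner_add_left[OF bsub_F_fin[OF assms(1)] bstar_F_fin[OF assms(1)] assms(2)]
      dinner_bsub[OF assms] bstar by (rule add.commute)
qed

lemma op_prod_Cons: "op_prod (A # As) f = A (op_prod As f)"
  by (simp add: op_prod_def)

text \<open>The outermost operator is moved to the right argument, where \<open>Gauss\<close> and
  \<open>gauss\<close> alike turn into \<open>gauss\<close>. Hence the induction over all
  \<open>g\<close>; membership in \<open>F_fin\<close> is carried along to justify the move.\<close>

lemma dinner_op_prod_Gauss:
  assumes "g \<in> F_fin"
  shows "op_prod (map (\<lambda>k. Gauss \<alpha> q (x k) (y k)) ks) vacuum \<in> F_fin \<and>
    op_prod (map (\<lambda>k. gauss \<alpha> q (x k) (y k)) ks) vacuum \<in> F_fin \<and>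
    dinner \<alpha> q (op_prod (map (\<lambda>k. Gauss \<alpha> q (x k) (y k)) ks) vacuum) g =
    dinner \<alpha> q (op_prod (map (\<lambda>k. gauss \<alpha> q (x k) (y k)) ks) vacuum) g"
  using assms
proof (induction ks arbitrary: g)
  case Nil
  then show ?case
    by (simp add: op_prod_def vacuum_F_fin)
next
  case (Cons k ks)
  then show ?case
    by (simp add: op_prod_Cons Gauss_F_fin gauss_F_fin dinner_Gauss)
qed

lemma dinner_vacuum:
  assumes "g \<in> F_fin"
  shows "dinner \<alpha> q vacuum g = g 0 (\<lambda>_. 0)"
proof -
  have "dinner \<alpha> q vacuum g = (\<Sum>n<1. tinner n (vacuum n) (Pn \<alpha> q n (g n)))"
    using assms by (intro dinner_eq_sum vacuum_F_fin) (simp_all add: vacuum_def)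
  then show ?thesis
    using F_finD[OF assms] by (simp add: vacuum_def Pn_0 tinner_tens_left)
qed

lemma vacuum_state_Gauss:
  "vacuum_state \<alpha> q (op_prod (map (\<lambda>k. Gauss \<alpha> q (x k) (y k)) ks)) =
    op_prod (map (\<lambda>k. gauss \<alpha> q (x k) (y k)) ks) vacuum 0 (\<lambda>_. 0)"
proof -
  let ?f = "op_prod (map (\<lambda>k. Gauss \<alpha> q (x k) (y k)) ks) vacuum"
  let ?g = "op_prod (map (\<lambda>k. gauss \<alpha> q (x k) (y k)) ks) vacuum"
  have F: "?f \<in> F_fin" "?g \<in> F_fin" "dinner \<alpha> q ?f vacuum = dinner \<alpha> q ?g vacuum"
    using dinner_op_prod_Gauss[OF vacuum_F_fin] by blast+
  \<comment> \<open>The comparison above has the products on the left, the vacuum state has them on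
    the right; Hermitian symmetry mediates.\<close>
  have "dinner \<alpha> q vacuum ?f = dinner \<alpha> q vacuum ?g"
    unfolding dinner_commute[OF F(1) vacuum_F_fin] dinner_commute[OF F(2) vacuum_F_fin] F(3) ..
  then show ?thesis
    unfolding vacuum_state_def by (simp only: dinner_vacuum[OF F(2)])
qed


section \<open>Pair partitions as sets of arcs\<close>

text \<open>A B-pair is represented by its member \<open>(a, b)\<close> with \<open>\<bar>a\<bar> < b\<close>. In \<open>matchings N m S\<close>, the
  indices in \<open>S\<close> are left open by the first \<open>m\<close> steps, and must be matched with an index
  exceeding \<open>m\<close>.\<close>

definition legs :: "int \<times> int \<Rightarrow> int set" where
  "legs p = {fst p, snd p, - fst p, - snd p}"

definition matchings :: "int \<Rightarrow> int \<Rightarrow> int set \<Rightarrow> (int \<times> int) set set" where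
  "matchings N m S = {M. (\<forall>p\<in>M. \<bar>fst p\<bar> < snd p \<and> m < snd p \<and> snd p \<le> N \<and> (fst p \<in> S \<or> m < \<bar>fst p\<bar>)) \<and>
     (\<forall>t. t \<in> S \<or> m < \<bar>t\<bar> \<and> \<bar>t\<bar> \<le> N \<longrightarrow> (\<exists>!p. p \<in> M \<and> t \<in> legs p))}"

definition negative_arcs :: "(int \<times> int) set \<Rightarrow> (int \<times> int) set" where
  "negative_arcs M = {p \<in> M. fst p < 0}"

text \<open>Ordering two arcs by their right ends lists each crossing once, with the arc that closes
  earlier in front.\<close>

definition crossings :: "(int \<times> int) set \<Rightarrow> ((int \<times> int) \<times> (int \<times> int)) set" where
  "crossings M = {(p, p'). p \<in> M \<and> p' \<in> M \<and> snd p < snd p' \<and> fst p < fst p' \<and> fst p' < snd p}"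

text \<open>This is \<open>crosses (reflect p) p'\<close>: the inequality
  \<open>- fst p < snd p'\<close> follows from \<open>\<bar>fst p\<bar> < snd p\<close> and
  \<open>snd p < snd p'\<close> for the arcs considered. The crossing condition is symmetric, so the
  order of right ends selects one of two listings.\<close>

definition mirror_crossings :: "(int \<times> int) set \<Rightarrow> ((int \<times> int) \<times> (int \<times> int)) set" where
  "mirror_crossings M =
    {(p, p'). p \<in> M \<and> p' \<in> M \<and> snd p < snd p' \<and> - snd p < fst p' \<and> fst p' < - fst p}"

definition arc_weight :: "real \<Rightarrow> real \<Rightarrow> (int \<Rightarrow> 'a::real_inner) \<Rightarrow> (int \<times> int) set \<Rightarrow> real" where
  "arc_weight \<alpha> q x M = \<alpha> ^ card (negative_arcs M) *
     q ^ (card (crossings M) + card (mirror_crossings M)) *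
     (\<Prod>(a, b)\<in>M. (x a \<bullet> x b) * (x (- a) \<bullet> x (- b)))"

lemma matchingsD:
  assumes "M \<in> matchings N m S" "p \<in> M"
  shows "\<bar>fst p\<bar> < snd p" "m < snd p" "snd p \<le> N" "fst p \<in> S \<or> m < \<bar>fst p\<bar>"
  using assms by (auto simp: matchings_def)

lemma matchings_ex:
  assumes "M \<in> matchings N m S" "t \<in> S \<or> m < \<bar>t\<bar> \<and> \<bar>t\<bar> \<le> N"
  obtains p where "p \<in> M" "t \<in> legs p"
  using assms unfolding matchings_def by blast

lemma matchings_unique:
  assumes "M \<in> matchings N m S" "t \<in> S \<or> m < \<bar>t\<bar> \<and> \<bar>t\<bar> \<le> N"
    "p \<in> M" "p' \<in> M" "t \<in> legs p" "t \<in> legs p'"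
  shows "p = p'"
  using assms unfolding matchings_def by blast

lemma matchingsI:
  assumes "\<And>p. p \<in> M \<Longrightarrow> \<bar>fst p\<bar> < snd p" "\<And>p. p \<in> M \<Longrightarrow> m < snd p" "\<And>p. p \<in> M \<Longrightarrow> snd p \<le> N"
    "\<And>p. p \<in> M \<Longrightarrow> fst p \<in> S \<or> m < \<bar>fst p\<bar>"
    "\<And>t. t \<in> S \<or> m < \<bar>t\<bar> \<and> \<bar>t\<bar> \<le> N \<Longrightarrow> \<exists>p\<in>M. t \<in> legs p"
    "\<And>t p p'. t \<in> S \<or> m < \<bar>t\<bar> \<and> \<bar>t\<bar> \<le> N \<Longrightarrow> p \<in> M \<Longrightarrow> p' \<in> M \<Longrightarrow> t \<in> legs p \<Longrightarrow> t \<in> legs p' \<Longrightarrow> p = p'"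
  shows "M \<in> matchings N m S"
proof -
  have "\<exists>!p. p \<in> M \<and> t \<in> legs p" if "t \<in> S \<or> m < \<bar>t\<bar> \<and> \<bar>t\<bar> \<le> N" for t
    using assms(5)[OF that] assms(6)[OF that] by blast
  then show ?thesis
    unfolding matchings_def using assms(1-4) by simp
qed

lemma matchings_subset:
  assumes "M \<in> matchings N m S"
  shows "M \<subseteq> {- N..N} \<times> {- N..N}"
proof
  fix p assume "p \<in> M"
  then have "\<bar>fst p\<bar> < snd p" "snd p \<le> N"
    using matchingsD[OF assms] by blast+
  then show "p \<in> {- N..N} \<times> {- N..N}"
    by (auto simp: mem_Times_iff)
qed

lemma finite_matching: "M \<in> matchings N m S \<Longrightarrow> finite M"
  by (rule finite_subset[OF matchings_subset]) auto

lemma finite_matchings: "finite (matchings N m S)"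
proof (rule finite_subset)
  show "matchings N m S \<subseteq> Pow ({- N..N} \<times> {- N..N})"
    by (rule subsetI) (rule PowI[OF matchings_subset])
qed simp

text \<open>No right end fits above \<open>N\<close> and below \<open>N + 1\<close>, so only the
  empty matching remains, and it cannot serve an open index.\<close>

lemma matchings_last:
  "matchings N N S = (if S = {} then {{}} else {})"
proof -
  have "M = {}" if "M \<in> matchings N N S" for M
    using matchingsD(2,3)[OF that] by fastforce
  moreover have "{} \<in> matchings N N S \<longleftrightarrow> S = {}"
    by (auto simp: matchings_def)
  ultimately show ?thesis
    by auto
qed

section \<open>One step of the recursion for matchings\<close>

context
  fixes N m :: int and S :: "int set"
  assumes m: "0 \<le> m" "m < N" and S: "S \<subseteq> {- m..m} - {0}"
begin

lemma open_abs: "t \<in> S \<Longrightarrow> \<bar>t\<bar> \<le> m \<and> t \<noteq> 0"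
  using S by fastforce

text \<open>The counterpart of creation: if \<open>m + 1\<close> is no right end, it is a left end
  up to sign, so it joins the open indices together with \<open>- (m + 1)\<close>.\<close>

lemma matchings_skip:
  "M \<in> matchings N (m + 1) (S \<union> {m + 1, - (m + 1)}) \<longleftrightarrow>
    M \<in> matchings N m S \<and> (\<forall>p\<in>M. snd p \<noteq> m + 1)"
proof -
  have "t \<in> S \<union> {m + 1, - (m + 1)} \<or> m + 1 < \<bar>t\<bar> \<and> \<bar>t\<bar> \<le> N \<longleftrightarrow> t \<in> S \<or> m < \<bar>t\<bar> \<and> \<bar>t\<bar> \<le> N" for t
    using m by auto
  moreover have "\<bar>a\<bar> < b \<and> m + 1 < b \<and> b \<le> N \<and> (a \<in> S \<union> {m + 1, - (m + 1)} \<or> m + 1 < \<bar>a\<bar>) \<longleftrightarrow>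
      (\<bar>a\<bar> < b \<and> m < b \<and> b \<le> N \<and> (a \<in> S \<or> m < \<bar>a\<bar>)) \<and> b \<noteq> m + 1" for a b
    by auto
  ultimately show ?thesis
    unfolding matchings_def mem_Collect_eq ball_conj_distrib[symmetric]
    by (simp only: ball_conj_distrib) blast
qed

text \<open>The counterpart of annihilation. Taking \<open>a\<close> and \<open>- a\<close> out of
  the open set keeps the arcs of \<open>M\<close> away from both, and their right ends lie beyond
  \<open>m + 1\<close>, so the new arc shares no leg with them.\<close>

lemma matchings_close:
  assumes a: "a \<in> S" and M: "M \<in> matchings N (m + 1) (S - {a, - a})"
  shows "insert (a, m + 1) M \<in> matchings N m S"
proof -
  have far: "t \<notin> legs p" if "p \<in> M" "t \<in> legs (a, m + 1)" for p t
    using matchingsD[OF M that(1)] that(2) open_abs[OF a] open_abs[of "fst p"]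
    by (auto simp: legs_def)
  have range: "t \<in> legs (a, m + 1) \<or> t \<in> S - {a, - a} \<or> m + 1 < \<bar>t\<bar> \<and> \<bar>t\<bar> \<le> N"
    if "t \<in> S \<or> m < \<bar>t\<bar> \<and> \<bar>t\<bar> \<le> N" for t
    using that by (auto simp: legs_def)
  show ?thesis
  proof (rule matchingsI)
    fix p assume p: "p \<in> insert (a, m + 1) M"
    then show "\<bar>fst p\<bar> < snd p" "m < snd p" "snd p \<le> N" "fst p \<in> S \<or> m < \<bar>fst p\<bar>"
      using matchingsD[OF M, of p] m open_abs[OF a] a by auto
  next
    fix t assume t: "t \<in> S \<or> m < \<bar>t\<bar> \<and> \<bar>t\<bar> \<le> N"
    show "\<exists>p\<in>insert (a, m + 1) M. t \<in> legs p"
      using range[OF t] matchings_ex[OF M, of t] by blast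
    fix p p' assume "p \<in> insert (a, m + 1) M" "p' \<in> insert (a, m + 1) M" "t \<in> legs p" "t \<in> legs p'"
    then show "p = p'"
      using range[OF t] matchings_unique[OF M, of t p p'] far by blast
  qed
qed

text \<open>Inverts \<open>matchings_close\<close>: uniqueness at the legs \<open>m + 1\<close> and
  \<open>a\<close> keeps the other arcs away from these indices and their negatives.\<close>

lemma matchings_open:
  assumes M: "M \<in> matchings N m S" and p: "(a, m + 1) \<in> M"
  shows "a \<in> S" "M - {(a, m + 1)} \<in> matchings N (m + 1) (S - {a, - a})"
proof -
  show a: "a \<in> S"
    using matchingsD[OF M p] by auto
  have other: "snd p' \<noteq> m + 1" "\<bar>fst p'\<bar> \<noteq> m + 1" "fst p' \<noteq> a" "fst p' \<noteq> - a"
    if p': "p' \<in> M - {(a, m + 1)}" for p'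
  proof -
    have no_leg: "t \<notin> legs p'" if "t = m + 1 \<or> t = a" for t
      using matchings_unique[OF M, of t "(a, m + 1)" p'] p p' that a m by (auto simp: legs_def)
    show "snd p' \<noteq> m + 1" "\<bar>fst p'\<bar> \<noteq> m + 1" "fst p' \<noteq> a" "fst p' \<noteq> - a"
      using no_leg[of "m + 1"] no_leg[of a] by (auto simp: legs_def)
  qed
  have range: "(t \<in> S \<or> m < \<bar>t\<bar> \<and> \<bar>t\<bar> \<le> N) \<and> t \<notin> legs (a, m + 1)"
    if "t \<in> S - {a, - a} \<or> m + 1 < \<bar>t\<bar> \<and> \<bar>t\<bar> \<le> N" for t
    using that open_abs[of t] open_abs[OF a] by (auto simp: legs_def)
  show "M - {(a, m + 1)} \<in> matchings N (m + 1) (S - {a, - a})"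
  proof (rule matchingsI)
    fix p assume p: "p \<in> M - {(a, m + 1)}"
    then show "\<bar>fst p\<bar> < snd p" "m + 1 < snd p" "snd p \<le> N"
      "fst p \<in> S - {a, - a} \<or> m + 1 < \<bar>fst p\<bar>"
      using matchingsD[OF M, of p] other[OF p] by auto
  next
    fix t assume t: "t \<in> S - {a, - a} \<or> m + 1 < \<bar>t\<bar> \<and> \<bar>t\<bar> \<le> N"
    show "\<exists>p\<in>M - {(a, m + 1)}. t \<in> legs p"
      using range[OF t] matchings_ex[OF M, of t] by blast
    fix p p' assume "p \<in> M - {(a, m + 1)}" "p' \<in> M - {(a, m + 1)}" "t \<in> legs p" "t \<in> legs p'"
    then show "p = p'"
      using range[OF t] matchings_unique[OF M, of t p p'] by blast
  qed
qed

text \<open>Each counted \<open>t\<close> lies on exactly one arc of \<open>M\<close>, as its left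
  end or as the negative of it. The bounds by \<open>m + 1\<close> restrict the arcs to those
  starting at an open index.\<close>

lemma card_crossing_arcs:
  assumes sym: "\<forall>t\<in>S. - t \<in> S" and a: "a \<in> S"
    and M: "M \<in> matchings N (m + 1) (S - {a, - a})"
  shows "card {p \<in> M. a < fst p \<and> fst p < m + 1} + card {p \<in> M. - (m + 1) < fst p \<and> fst p < - a} =
    card {t \<in> S - {a, - a}. a < t}"
proof -
  let ?A = "{p \<in> M. a < fst p \<and> fst p < m + 1}" and ?B = "{p \<in> M. - (m + 1) < fst p \<and> fst p < - a}"
  have in_S: "fst p \<in> S - {a, - a}" if "p \<in> ?A \<union> ?B" for p
    using that matchingsD[OF M, of p] open_abs[OF a] by auto
  have in_S': "- fst p \<in> S - {a, - a}" if "p \<in> ?A \<union> ?B" for p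
    using in_S[OF that] sym by auto
  have unique: "p = p'" if "p \<in> ?A \<union> ?B" "p' \<in> ?A \<union> ?B" "fst p = fst p' \<or> fst p = - fst p'" for p p'
    using that matchings_unique[OF M, of "fst p" p p'] in_S[OF that(1)] by (auto simp: legs_def)
  have "{t \<in> S - {a, - a}. a < t} = fst ` ?A \<union> (\<lambda>p. - fst p) ` ?B"
  proof (intro equalityI subsetI)
    fix t assume t: "t \<in> {t \<in> S - {a, - a}. a < t}"
    then obtain p where p: "p \<in> M" "t \<in> legs p"
      using matchings_ex[OF M, of t] by blast
    have abs: "\<bar>t\<bar> \<le> m" "a < t"
      using t open_abs[of t] by auto
    then consider "t = fst p" | "t = - fst p"
      using matchingsD(2)[OF M p(1)] p(2) by (auto simp: legs_def)
    then show "t \<in> fst ` ?A \<union> (\<lambda>p. - fst p) ` ?B"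
    proof cases
      case 1
      then have "p \<in> ?A"
        using p(1) abs by simp
      then show ?thesis
        unfolding 1 by blast
    next
      case 2
      then have "p \<in> ?B"
        using p(1) abs by simp
      then show ?thesis
        unfolding 2 by blast
    qed
  next
    fix t assume "t \<in> fst ` ?A \<union> (\<lambda>p. - fst p) ` ?B"
    then show "t \<in> {t \<in> S - {a, - a}. a < t}"
    proof (elim UnE imageE)
      fix p assume p: "t = fst p" "p \<in> ?A"
      then show ?thesis
        using in_S[OF UnI1[OF p(2)]] by simp
    next
      fix p assume p: "t = - fst p" "p \<in> ?B"
      then show ?thesis
        using in_S'[OF UnI2[OF p(2)]] by simp
    qed
  qed
  \<comment> \<open>A common value would make one arc start at both \<open>t\<close> and
    \<open>- t\<close>, that is, at 0, which is not an index.\<close>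
  moreover have "fst ` ?A \<inter> (\<lambda>p. - fst p) ` ?B = {}"
  proof (intro equals0I, elim IntE imageE)
    fix t p p' assume "t = fst p" "p \<in> ?A" "t = - fst p'" "p' \<in> ?B"
    then have p: "p \<in> ?A \<union> ?B" "p' \<in> ?A \<union> ?B" "fst p = - fst p'"
      by simp_all
    then have "p = p'"
      using unique by blast
    then have "fst p = 0"
      using p(3) by simp
    then show False
      using in_S[OF p(1)] open_abs[of "fst p"] by blast
  qed
  moreover have "finite ?A" "finite ?B"
    using finite_matching[OF M] by auto
  ultimately have "card {t \<in> S - {a, - a}. a < t} = card (fst ` ?A) + card ((\<lambda>p. - fst p) ` ?B)"
    by (simp only: card_Un_disjoint finite_imageI)
  moreover have "inj_on fst ?A" "inj_on (\<lambda>p. - fst p) ?B"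
    using unique by (auto simp: inj_on_def)
  ultimately show ?thesis
    by (simp only: card_image)
qed

text \<open>All right ends in \<open>M\<close> exceed \<open>m + 1\<close>, so the new arc is the
  first member of every crossing it enters. The new crossings of the two kinds are given by
  \<open>?A\<close> and \<open>?B\<close>, and \<open>card_crossing_arcs\<close> turns their number
  into the deletion weight.\<close>

lemma arc_weight_insert:
  assumes sym: "\<forall>t\<in>S. - t \<in> S" and a: "a \<in> S"
    and M: "M \<in> matchings N (m + 1) (S - {a, - a})"
  shows "arc_weight \<alpha> q x (insert (a, m + 1) M) = del_weight \<alpha> q S a *
    (x a \<bullet> x (m + 1)) * (x (- a) \<bullet> x (- (m + 1))) * arc_weight \<alpha> q x M"
proof -
  let ?p = "(a, m + 1)" and ?A = "{p \<in> M. a < fst p \<and> fst p < m + 1}"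
    and ?B = "{p \<in> M. - (m + 1) < fst p \<and> fst p < - a}"
  have later: "m + 1 < snd p" if "p \<in> M" for p
    using matchingsD[OF M that] by simp
  have p: "?p \<notin> M"
    using later by fastforce
  have fin: "finite M"
    using finite_matching[OF M] .
  have "negative_arcs (insert ?p M) = (if a < 0 then insert ?p (negative_arcs M) else negative_arcs M)"
    by (auto simp: negative_arcs_def)
  moreover have "?p \<notin> negative_arcs M" "finite (negative_arcs M)"
    using p fin by (auto simp: negative_arcs_def)
  ultimately have neg: "\<alpha> ^ card (negative_arcs (insert ?p M)) =
      (if a < 0 then \<alpha> else 1) * \<alpha> ^ card (negative_arcs M)"
    by simp
  have card_cross: "card (C \<union> Pair ?p ` X) = card C + card X"
    if "C \<subseteq> M \<times> M" "X \<subseteq> M" for C :: "((int \<times> int) \<times> int \<times> int) set" and X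
  proof -
    have "finite C" "finite X" "C \<inter> Pair ?p ` X = {}"
      using that p fin by (auto intro: finite_subset)
    then show ?thesis
      by (simp add: card_Un_disjoint card_image inj_on_def)
  qed
  have crossings: "(v, w) \<in> crossings (insert ?p M) \<longleftrightarrow> (v, w) \<in> crossings M \<union> Pair ?p ` ?A" for v w
    using later[of v] later[of w] by (auto simp: crossings_def)
  have "crossings (insert ?p M) = crossings M \<union> Pair ?p ` ?A"
    by (intro equalityI subrelI) (simp_all only: crossings)
  then have card1: "card (crossings (insert ?p M)) = card (crossings M) + card ?A"
    using card_cross[of "crossings M" ?A] by (auto simp: crossings_def)
  have mirror_crossings: "(v, w) \<in> mirror_crossings (insert ?p M) \<longleftrightarrow> (v, w) \<in> mirror_crossings M \<union> Pair ?p ` ?B" for v w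
    using later[of v] later[of w] by (auto simp: mirror_crossings_def)
  have "mirror_crossings (insert ?p M) = mirror_crossings M \<union> Pair ?p ` ?B"
    by (intro equalityI subrelI) (simp_all only: mirror_crossings)
  then have card2: "card (mirror_crossings (insert ?p M)) = card (mirror_crossings M) + card ?B"
    using card_cross[of "mirror_crossings M" ?B] by (auto simp: mirror_crossings_def)
  have "card (crossings (insert ?p M)) + card (mirror_crossings (insert ?p M)) =
      card {t \<in> S - {a, - a}. a < t} + (card (crossings M) + card (mirror_crossings M))"
    using card_crossing_arcs[OF sym a M] card1 card2 by linarith
  then have "q ^ (card (crossings (insert ?p M)) + card (mirror_crossings (insert ?p M))) =
      q ^ card {t \<in> S - {a, - a}. a < t} * q ^ (card (crossings M) + card (mirror_crossings M))"
    by (simp only: power_add)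
  then show ?thesis
    unfolding arc_weight_def neg del_weight_def using p fin by (simp add: mult_ac)
qed

text \<open>The matchings are split by the role of \<open>m + 1\<close>. All other arcs end beyond
  \<open>m + 1\<close>, so an inserted arc can be recovered from the matching; this gives
  disjointness and injectivity.\<close>

lemma sum_matchings_step:
  assumes sym: "\<forall>t\<in>S. - t \<in> S"
  shows "(\<Sum>M\<in>matchings N m S. arc_weight \<alpha> q x M) =
    (\<Sum>M\<in>matchings N (m + 1) (S \<union> {m + 1, - (m + 1)}). arc_weight \<alpha> q x M) +
    (\<Sum>a\<in>S. del_weight \<alpha> q S a * (x a \<bullet> x (m + 1)) * (x (- a) \<bullet> x (- (m + 1))) *
      (\<Sum>M\<in>matchings N (m + 1) (S - {a, - a}). arc_weight \<alpha> q x M))"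
proof -
  let ?w = "arc_weight \<alpha> q x"
  let ?skip = "matchings N (m + 1) (S \<union> {m + 1, - (m + 1)})"
  let ?close = "\<lambda>a. insert (a, m + 1) ` matchings N (m + 1) (S - {a, - a})"
  have finS: "finite S"
    using S by (rule finite_subset) simp
  have fresh: "(a', m + 1) \<notin> M" if "M \<in> matchings N (m + 1) S'" for a' M S'
    using matchingsD(2)[OF that, of "(a', m + 1)"] by auto
  have split: "matchings N m S = ?skip \<union> (\<Union>a\<in>S. ?close a)"
  proof (intro equalityI subsetI)
    fix M assume M: "M \<in> matchings N m S"
    show "M \<in> ?skip \<union> (\<Union>a\<in>S. ?close a)"
    proof (cases "\<forall>p\<in>M. snd p \<noteq> m + 1")
      case False
      then obtain a where p: "(a, m + 1) \<in> M"
        by auto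
      then have "M = insert (a, m + 1) (M - {(a, m + 1)})"
        by auto
      then show ?thesis
        using matchings_open[OF M p] by blast
    qed (use M matchings_skip in blast)
  qed (use matchings_skip matchings_close in blast)
  have "?skip \<inter> (\<Union>a\<in>S. ?close a) = {}"
    using fresh by blast
  then have "sum ?w (matchings N m S) = sum ?w ?skip + sum ?w (\<Union>a\<in>S. ?close a)"
    unfolding split using finS by (intro sum.union_disjoint) (auto simp: finite_matchings)
  also have "sum ?w (\<Union>a\<in>S. ?close a) = (\<Sum>a\<in>S. sum ?w (?close a))"
  proof -
    have "a = b" if "insert (a, m + 1) M = insert (b, m + 1) M'" "M' \<in> matchings N (m + 1) S'" for a b M M' S'
      using fresh[OF that(2), of a] that(1) by blast
    then have "\<forall>a\<in>S. \<forall>b\<in>S. a \<noteq> b \<longrightarrow> ?close a \<inter> ?close b = {}"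
      by blast
    then show ?thesis
      using finS by (intro sum.UNION_disjoint[of S ?close ?w]) (simp_all add: finite_matchings)
  qed
  also have "\<dots> = (\<Sum>a\<in>S. \<Sum>M\<in>matchings N (m + 1) (S - {a, - a}). ?w (insert (a, m + 1) M))"
  proof (rule sum.cong[OF refl])
    fix a assume "a \<in> S"
    have "inj_on (insert (a, m + 1)) (matchings N (m + 1) (S - {a, - a}))"
      using fresh by (intro inj_onI) (metis insert_ident)
    then show "sum ?w (?close a) = (\<Sum>M\<in>matchings N (m + 1) (S - {a, - a}). ?w (insert (a, m + 1) M))"
      by (simp add: sum.reindex)
  qed
  also have "\<dots> = (\<Sum>a\<in>S. del_weight \<alpha> q S a * (x a \<bullet> x (m + 1)) * (x (- a) \<bullet> x (- (m + 1))) *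
      (\<Sum>M\<in>matchings N (m + 1) (S - {a, - a}). ?w M))"
    unfolding sum_distrib_left using arc_weight_insert[OF sym] by (intro sum.cong refl) blast
  finally show ?thesis .
qed

end


section \<open>Translating the statistics of pair partitions to arcs\<close>

definition arcs :: "int set set \<Rightarrow> (int \<times> int) set" where
  "arcs \<pi> = {(a, b). {a, b} \<in> \<pi> \<and> \<bar>a\<bar> < b}"

definition blocks_of :: "(int \<times> int) set \<Rightarrow> int set set" where
  "blocks_of M = {V. \<exists>p\<in>M. V = {fst p, snd p} \<or> V = {- fst p, - snd p}}"

context
  fixes \<pi> n
  assumes \<pi>: "\<pi> \<in> pair_partitions_B n"
begin

lemma block_unique: "V \<in> \<pi> \<Longrightarrow> W \<in> \<pi> \<Longrightarrow> t \<in> V \<Longrightarrow> t \<in> W \<Longrightarrow> V = W"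
  using \<pi> unfolding pair_partitions_B_def partition_on_def disjoint_def by blast

lemma block_minus: "{a, b} \<in> \<pi> \<Longrightarrow> {- a, - b} \<in> \<pi>"
  using \<pi> unfolding pair_partitions_B_def by fastforce

lemma block_pm: "{a, b} \<in> \<pi> \<Longrightarrow> a \<in> pm n \<and> b \<in> pm n"
  using \<pi> unfolding pair_partitions_B_def partition_on_def by blast

text \<open>A block \<open>{a, - a}\<close> would be its own reflection. Hence one entry dominates
  in absolute value, which fixes the orientation of the arc.\<close>

lemma block_abs: "{a, b} \<in> \<pi> \<Longrightarrow> \<bar>a\<bar> \<noteq> \<bar>b\<bar>"
proof
  assume V: "{a, b} \<in> \<pi>" and "\<bar>a\<bar> = \<bar>b\<bar>"
  then have "b = a \<or> b = - a"
    by arith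
  moreover have "card {a, b} = 2" "uminus ` {a, b} \<noteq> {a, b}"
    using \<pi> V unfolding pair_partitions_B_def by blast+
  ultimately show False
    by auto
qed

lemma block_exists:
  assumes "V \<in> \<pi>"
  obtains p where "p \<in> arcs \<pi>" "V = {fst p, snd p} \<or> V = {- fst p, - snd p}"
proof -
  have "card V = 2"
    using assms \<pi> unfolding pair_partitions_B_def by blast
  then obtain a b where V: "V = {a, b}"
    unfolding card_2_iff by blast
  have mem: "{a, b} \<in> \<pi>" "{- a, - b} \<in> \<pi>"
    using assms V block_minus by simp_all
  then have mem': "{b, a} \<in> \<pi>" "{- b, - a} \<in> \<pi>"
    by (simp_all only: insert_commute)
  \<comment> \<open>The entry of larger absolute value, reflected if it is negative, becomes the
    right end.\<close>
  consider "\<bar>a\<bar> < b" | "\<bar>a\<bar> < - b" | "\<bar>b\<bar> < a" | "\<bar>b\<bar> < - a"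
    using block_abs[OF mem(1)] by linarith
  then show ?thesis
  proof cases
    case 1
    then show ?thesis
      using that[of "(a, b)"] V mem by (simp add: arcs_def)
  next
    case 2
    then show ?thesis
      using that[of "(- a, - b)"] V mem by (simp add: arcs_def)
  next
    case 3
    then show ?thesis
      using that[of "(b, a)"] V mem' by (simp add: arcs_def insert_commute)
  next
    case 4
    then show ?thesis
      using that[of "(- b, - a)"] V mem' by (simp add: arcs_def insert_commute)
  qed
qed

lemma arcs_blocks:
  assumes "p \<in> arcs \<pi>"
  shows "{fst p, snd p} \<in> \<pi>" "{- fst p, - snd p} \<in> \<pi>" "\<bar>fst p\<bar> < snd p"
  using assms block_minus by (auto simp: arcs_def)

lemma arcs_unique:
  assumes "p \<in> arcs \<pi>" "p' \<in> arcs \<pi>" "t \<in> legs p" "t \<in> legs p'"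
  shows "p = p'"
proof -
  obtain V where V: "V = {fst p, snd p} \<or> V = {- fst p, - snd p}" "t \<in> V" "V \<in> \<pi>"
    using arcs_blocks[OF assms(1)] assms(3) by (auto simp: legs_def)
  obtain W where W: "W = {fst p', snd p'} \<or> W = {- fst p', - snd p'}" "t \<in> W" "W \<in> \<pi>"
    using arcs_blocks[OF assms(2)] assms(4) by (auto simp: legs_def)
  have "V = W"
    using V W block_unique by blast
  then show ?thesis
    using V(1) W(1) arcs_blocks(3)[OF assms(1)] arcs_blocks(3)[OF assms(2)]
    by (auto simp: doubleton_eq_iff prod_eq_iff)
qed

lemma arcs_matching: "arcs \<pi> \<in> matchings (int n) 0 {}"
proof (rule matchingsI)
  fix p assume p: "p \<in> arcs \<pi>"
  have "fst p \<in> pm n" "snd p \<in> pm n"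
    using block_pm arcs_blocks(1)[OF p] by blast+
  then show "\<bar>fst p\<bar> < snd p" "0 < snd p" "snd p \<le> int n" "fst p \<in> {} \<or> 0 < \<bar>fst p\<bar>"
    using arcs_blocks(3)[OF p] by (auto simp: pm_def)
next
  fix t :: int assume "t \<in> {} \<or> 0 < \<bar>t\<bar> \<and> \<bar>t\<bar> \<le> int n"
  then have "t \<in> \<Union>\<pi>"
    using \<pi> by (auto simp: pair_partitions_B_def partition_on_def pm_def)
  then obtain V where V: "V \<in> \<pi>" "t \<in> V"
    by blast
  obtain p where "p \<in> arcs \<pi>" "V = {fst p, snd p} \<or> V = {- fst p, - snd p}"
    using block_exists[OF V(1)] .
  then show "\<exists>p\<in>arcs \<pi>. t \<in> legs p"
    using V(2) by (auto simp: legs_def)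
qed (rule arcs_unique)

lemma blocks_of_arcs: "blocks_of (arcs \<pi>) = \<pi>"
proof (intro equalityI subsetI)
  fix V assume "V \<in> blocks_of (arcs \<pi>)"
  then show "V \<in> \<pi>"
    unfolding blocks_of_def using arcs_blocks(1,2) by blast
next
  fix V assume "V \<in> \<pi>"
  then show "V \<in> blocks_of (arcs \<pi>)"
    unfolding blocks_of_def using block_exists by blast
qed

lemma Pair_B_eq: "Pair_B \<pi> = (\<lambda>p. (reflect p, p)) ` arcs \<pi>"
proof -
  have "reflect (a, b) \<in> Pair_blocks \<pi> \<and> (a, b) \<in> Pair_blocks \<pi> \<and> b > 0 \<and> \<bar>a\<bar> < b \<longleftrightarrow>
      (a, b) \<in> arcs \<pi>" for a b
    using block_minus[of a b] by (auto simp: Pair_blocks_def arcs_def reflect_def insert_commute)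
  then show ?thesis
    unfolding Pair_B_def by (auto simp: image_iff)
qed

text \<open>Right ends are positive and 0 is not an index, so the sign of the product is that of the
  left end.\<close>

lemma Nb_eq: "Nb \<pi> = card (negative_arcs (arcs \<pi>))"
proof -
  have "\<not> 0 < fst p * snd p \<longleftrightarrow> fst p < 0" if "p \<in> arcs \<pi>" for p
    using matchingsD[OF arcs_matching that] by (auto simp: zero_less_mult_iff)
  then have neg: "{p \<in> arcs \<pi>. \<not> 0 < fst p * snd p} = negative_arcs (arcs \<pi>)"
    unfolding negative_arcs_def by blast
  have "{p \<in> Pair_B \<pi>. \<not> fst (snd p) * snd (snd p) > 0} =
      (\<lambda>p. (reflect p, p)) ` {p \<in> arcs \<pi>. \<not> 0 < fst p * snd p}"
    unfolding Pair_B_eq by auto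
  then show ?thesis
    unfolding Nb_def neg by (simp add: card_image inj_on_def)
qed

text \<open>The strict order of the right ends recovers the ordered pair from the unordered
  one.\<close>

lemma card_unordered_arcs:
  assumes "\<And>p p'. (p, p') \<in> C \<Longrightarrow> snd p < snd p'"
  shows "card ((\<lambda>(p, p'). {(reflect p, p), (reflect p', p')}) ` C) = card C"
proof (rule card_image, rule inj_onI)
  fix c c' assume c: "c \<in> C" "c' \<in> C"
    and "(\<lambda>(p, p'). {(reflect p, p), (reflect p', p')}) c =
      (\<lambda>(p, p'). {(reflect p, p), (reflect p', p')}) c'"
  then have "{(reflect (fst c), fst c), (reflect (snd c), snd c)} =
      {(reflect (fst c'), fst c'), (reflect (snd c'), snd c')}"
    by (simp only: case_prod_unfold)
  then have "fst c = fst c' \<and> snd c = snd c' \<or> fst c = snd c' \<and> snd c = fst c'"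
    unfolding doubleton_eq_iff prod.inject by blast
  moreover have "snd (fst c) < snd (snd c)" "snd (fst c') < snd (snd c')"
    using c assms by simp_all
  ultimately show "c = c'"
    by (auto simp: prod_eq_iff)
qed

lemma Cr_eq: "Cr \<pi> = card (crossings (arcs \<pi>)) + card (mirror_crossings (arcs \<pi>))"
proof -
  let ?F = "\<lambda>(p, p'). {(reflect p, p), (reflect p', p')}"
  \<comment> \<open>\<open>C\<close> may list a pair in only one of its two orders; the unordered
    pair is the same.\<close>
  have ordered: "{{p, p'} | p p'. p \<in> Pair_B \<pi> \<and> p' \<in> Pair_B \<pi> \<and> p \<noteq> p' \<and> R p p'} = ?F ` C"
    if to_C: "\<And>v w. v \<in> arcs \<pi> \<Longrightarrow> w \<in> arcs \<pi> \<Longrightarrow> v \<noteq> w \<Longrightarrow> R (reflect v, v) (reflect w, w) \<Longrightarrow>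
        (v, w) \<in> C \<or> (w, v) \<in> C"
      and from_C: "\<And>v w. (v, w) \<in> C \<Longrightarrow>
        v \<in> arcs \<pi> \<and> w \<in> arcs \<pi> \<and> v \<noteq> w \<and> R (reflect v, v) (reflect w, w)"
    for R C
  proof (intro equalityI subsetI)
    fix X assume "X \<in> {{p, p'} | p p'. p \<in> Pair_B \<pi> \<and> p' \<in> Pair_B \<pi> \<and> p \<noteq> p' \<and> R p p'}"
    then obtain p p' where X: "X = {p, p'}" "p \<in> Pair_B \<pi>" "p' \<in> Pair_B \<pi>" "p \<noteq> p'" "R p p'"
      by blast
    then obtain v w where vw: "v \<in> arcs \<pi>" "w \<in> arcs \<pi>" "p = (reflect v, v)" "p' = (reflect w, w)"
      unfolding Pair_B_eq by blast
    then have "(v, w) \<in> C \<or> (w, v) \<in> C"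
      using X to_C[of v w] by blast
    moreover have "X = ?F (v, w)" "X = ?F (w, v)"
      using X(1) vw(3,4) by auto
    ultimately show "X \<in> ?F ` C"
      by blast
  next
    fix X assume "X \<in> ?F ` C"
    then obtain v w where vw: "(v, w) \<in> C" "X = {(reflect v, v), (reflect w, w)}"
      by auto
    then have "(reflect v, v) \<in> Pair_B \<pi>" "(reflect w, w) \<in> Pair_B \<pi>" "(reflect v, v) \<noteq> (reflect w, w)"
      "R (reflect v, v) (reflect w, w)"
      unfolding Pair_B_eq using from_C by blast+
    then show "X \<in> {{p, p'} | p p'. p \<in> Pair_B \<pi> \<and> p' \<in> Pair_B \<pi> \<and> p \<noteq> p' \<and> R p p'}"
      using vw(2) by blast
  qed
  have "{{p, p'} | p p'. p \<in> Pair_B \<pi> \<and> p' \<in> Pair_B \<pi> \<and> p \<noteq> p' \<and>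
      (crosses (snd p) (snd p') \<or> crosses (snd p') (snd p))} =
      ?F ` (crossings (arcs \<pi>) \<union> (crossings (arcs \<pi>))\<inverse>)"
    by (rule ordered) (auto simp: crossings_def crosses_def)
  \<comment> \<open>The two halves of the symmetric condition (i) yield the same unordered pairs, so
    they are counted once.\<close>
  moreover have "?F ` (crossings (arcs \<pi>))\<inverse> = ?F ` crossings (arcs \<pi>)"
    by (force simp: image_iff insert_commute)
  moreover have "{{p, p'} | p p'. p \<in> Pair_B \<pi> \<and> p' \<in> Pair_B \<pi> \<and> p \<noteq> p' \<and>
      crosses (fst p) (snd p')} = ?F ` mirror_crossings (arcs \<pi>)"
  proof (rule ordered)
    fix v w assume vw: "v \<in> arcs \<pi>" "w \<in> arcs \<pi>" "v \<noteq> w"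
      "crosses (fst (reflect v, v)) (snd (reflect w, w))"
    \<comment> \<open>Distinct arcs share no leg, so one of the two orders by right ends applies;
      the condition holds in either.\<close>
    have "snd v \<noteq> snd w"
      using arcs_unique[of v w "snd v"] vw(1-3) by (auto simp: legs_def)
    then show "(v, w) \<in> mirror_crossings (arcs \<pi>) \<or> (w, v) \<in> mirror_crossings (arcs \<pi>)"
      using vw by (simp add: mirror_crossings_def crosses_def reflect_def) linarith
  next
    fix v w assume vw: "(v, w) \<in> mirror_crossings (arcs \<pi>)"
    then have "\<bar>fst v\<bar> < snd v"
      using arcs_blocks(3) by (simp add: mirror_crossings_def)
    then show "v \<in> arcs \<pi> \<and> w \<in> arcs \<pi> \<and> v \<noteq> w \<and> crosses (fst (reflect v, v)) (snd (reflect w, w))"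
      using vw by (auto simp: mirror_crossings_def crosses_def reflect_def)
  qed
  moreover have "card (?F ` crossings (arcs \<pi>)) = card (crossings (arcs \<pi>))"
    "card (?F ` mirror_crossings (arcs \<pi>)) = card (mirror_crossings (arcs \<pi>))"
    by (rule card_unordered_arcs; simp add: crossings_def mirror_crossings_def)+
  ultimately show ?thesis
    unfolding Cr_def by (simp only: image_Un Un_absorb)
qed

lemma prod_Pair_blocks:
  fixes x :: "int \<Rightarrow> 'a::real_inner"
  shows "(\<Prod>(i, j)\<in>Pair_blocks \<pi>. x i \<bullet> x j) =
    (\<Prod>(a, b)\<in>arcs \<pi>. (x a \<bullet> x b) * (x (- a) \<bullet> x (- b)))"
proof -
  let ?f = "\<lambda>(i, j). x i \<bullet> x j"
  have "Pair_blocks \<pi> = arcs \<pi> \<union> reflect ` arcs \<pi>"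
  proof (intro equalityI subsetI, clarify)
    fix i j assume "(i, j) \<in> Pair_blocks \<pi>" and no: "(i, j) \<notin> reflect ` arcs \<pi>"
    then have ij: "i < j" "{i, j} \<in> \<pi>"
      by (auto simp: Pair_blocks_def)
    have "(- j, - i) \<notin> arcs \<pi>"
      using no by (force simp: reflect_def)
    then show "(i, j) \<in> arcs \<pi>"
      using ij block_minus[OF ij(2)] block_abs[OF ij(2)] by (auto simp: arcs_def insert_commute)
  next
    fix p assume "p \<in> arcs \<pi> \<union> reflect ` arcs \<pi>"
    then show "p \<in> Pair_blocks \<pi>"
      using block_minus by (auto simp: arcs_def Pair_blocks_def reflect_def insert_commute)
  qed
  moreover have "arcs \<pi> \<inter> reflect ` arcs \<pi> = {}"
    by (auto simp: arcs_def reflect_def)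
  moreover have "finite (arcs \<pi>)"
    using finite_matching[OF arcs_matching] .
  ultimately have "prod ?f (Pair_blocks \<pi>) = prod ?f (arcs \<pi>) * prod ?f (reflect ` arcs \<pi>)"
    by (simp add: prod.union_disjoint)
  also have "prod ?f (reflect ` arcs \<pi>) = (\<Prod>p\<in>arcs \<pi>. ?f (reflect p))"
    by (subst prod.reindex) (auto simp: inj_on_def reflect_def)
  also have "prod ?f (arcs \<pi>) * (\<Prod>p\<in>arcs \<pi>. ?f (reflect p)) =
      (\<Prod>(a, b)\<in>arcs \<pi>. (x a \<bullet> x b) * (x (- a) \<bullet> x (- b)))"
    unfolding prod.distrib[symmetric]
    by (intro prod.cong) (auto simp: reflect_def inner_commute)
  finally show ?thesis .
qed

end

text \<open>Distinct arcs have disjoint legs, and the two blocks of one arc are disjoint because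
  \<open>fst p\<close> is nonzero and smaller than \<open>snd p\<close> in absolute value. The last
  inequality also identifies the arc within its blocks.\<close>

lemma
  assumes M: "M \<in> matchings (int n) 0 {}"
  shows blocks_of_pair_partition: "blocks_of M \<in> pair_partitions_B n"
    and arcs_blocks_of: "arcs (blocks_of M) = M"
proof -
  have arc: "\<bar>fst p\<bar> < snd p" "fst p \<in> pm n" "snd p \<in> pm n" if "p \<in> M" for p
    using matchingsD[OF M that] by (auto simp: pm_def)
  have block: "\<exists>p\<in>M. V = {fst p, snd p} \<or> V = {- fst p, - snd p}" if "V \<in> blocks_of M" for V
    using that by (simp add: blocks_of_def)
  have "partition_on (pm n) (blocks_of M)"
  proof (rule partition_onI)
    show "\<Union>(blocks_of M) = pm n"
    proof (intro equalityI subsetI)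
      fix t assume "t \<in> \<Union>(blocks_of M)"
      then obtain V where V: "V \<in> blocks_of M" "t \<in> V"
        by blast
      obtain p where p: "p \<in> M" "V = {fst p, snd p} \<or> V = {- fst p, - snd p}"
        using block[OF V(1)] by blast
      then have "t = fst p \<or> t = snd p \<or> t = - fst p \<or> t = - snd p"
        using V(2) by blast
      then show "t \<in> pm n"
        using arc(2,3)[OF p(1)] by auto
    next
      fix t assume "t \<in> pm n"
      then have "0 < \<bar>t\<bar> \<and> \<bar>t\<bar> \<le> int n"
        by (auto simp: pm_def)
      then obtain p where "p \<in> M" "t \<in> legs p"
        using matchings_ex[OF M, of t] by blast
      then have "{fst p, snd p} \<in> blocks_of M" "{- fst p, - snd p} \<in> blocks_of M"
        "t \<in> {fst p, snd p} \<or> t \<in> {- fst p, - snd p}"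
        by (auto simp: blocks_of_def legs_def)
      then show "t \<in> \<Union>(blocks_of M)"
        by blast
    qed
    show "{} \<notin> blocks_of M"
      by (simp add: blocks_of_def)
    fix V W assume VW: "V \<in> blocks_of M" "W \<in> blocks_of M" "V \<noteq> W"
    obtain p where p: "p \<in> M" "V = {fst p, snd p} \<or> V = {- fst p, - snd p}"
      using block[OF VW(1)] by blast
    obtain p' where p': "p' \<in> M" "W = {fst p', snd p'} \<or> W = {- fst p', - snd p'}"
      using block[OF VW(2)] by blast
    have False if t: "t \<in> V" "t \<in> W" for t
    proof -
      have tl: "t \<in> legs p" "t \<in> legs p'"
        using t p(2) p'(2) unfolding legs_def by blast+
      then have "t \<in> pm n"
        using arc(2,3)[OF p(1)] by (auto simp: legs_def)
      then have "0 < \<bar>t\<bar> \<and> \<bar>t\<bar> \<le> int n"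
        by (auto simp: pm_def)
      then have eq: "p = p'"
        using matchings_unique[OF M _ p(1) p'(1) tl] by blast
      have "t \<in> {fst p, snd p} \<and> t \<in> {- fst p, - snd p}"
        using p(2) p'(2) VW(3) t unfolding eq by blast
      moreover have "fst p \<noteq> 0"
        using arc(2)[OF p(1)] by (simp add: pm_def)
      ultimately show False
        using arc(1)[OF p(1)] by auto
    qed
    then show "disjnt V W"
      by (auto simp: disjnt_def)
  qed
  moreover have "card V = 2 \<and> uminus ` V \<in> blocks_of M \<and> uminus ` V \<noteq> V" if "V \<in> blocks_of M" for V
  proof -
    obtain p where p: "p \<in> M" "V = {fst p, snd p} \<or> V = {- fst p, - snd p}"
      using block[OF \<open>V \<in> blocks_of M\<close>] by blast
    then have "uminus ` V = {- fst p, - snd p} \<or> uminus ` V = {fst p, snd p}"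
      by auto
    then have "uminus ` V \<in> blocks_of M"
      using p(1) by (auto simp: blocks_of_def)
    moreover have "fst p \<noteq> snd p" "fst p \<noteq> - snd p" "fst p \<noteq> - fst p"
      using arc(1,2)[OF p(1)] by (auto simp: pm_def)
    ultimately show ?thesis
      using p(2) by (auto simp: doubleton_eq_iff)
  qed
  ultimately show "blocks_of M \<in> pair_partitions_B n"
    by (simp add: pair_partitions_B_def)
  show "arcs (blocks_of M) = M"
  proof (intro equalityI subrelI)
    fix a b assume "(a, b) \<in> arcs (blocks_of M)"
    then have ab: "{a, b} \<in> blocks_of M" "\<bar>a\<bar> < b"
      by (auto simp: arcs_def)
    then obtain p where p: "p \<in> M" "{a, b} = {fst p, snd p} \<or> {a, b} = {- fst p, - snd p}"
      using block by blast
    then have "a = fst p \<and> b = snd p"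
      using ab(2) arc(1)[OF p(1)] by (auto simp: doubleton_eq_iff)
    then show "(a, b) \<in> M"
      using p(1) by simp
  next
    fix a b assume "(a, b) \<in> M"
    then show "(a, b) \<in> arcs (blocks_of M)"
      using arc(1)[of "(a, b)"] unfolding arcs_def blocks_of_def
      by (auto intro: bexI[of _ "(a, b)"])
  qed
qed

lemma sum_pair_partitions_B:
  fixes x :: "int \<Rightarrow> 'a::real_inner"
  shows "(\<Sum>\<pi>\<in>pair_partitions_B n. \<alpha> ^ Nb \<pi> * q ^ Cr \<pi> * (\<Prod>(i, j)\<in>Pair_blocks \<pi>. x i \<bullet> x j)) =
    (\<Sum>M\<in>matchings (int n) 0 {}. arc_weight \<alpha> q x M)"
  by (rule sum.reindex_bij_witness[where i = blocks_of and j = arcs])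
    (simp_all add: blocks_of_arcs arcs_matching arcs_blocks_of blocks_of_pair_partition
      arc_weight_def Nb_eq Cr_eq prod_Pair_blocks)


section \<open>The moments of the Gaussian operators\<close>

definition elem :: "nat \<Rightarrow> (int \<Rightarrow> 'a::real_inner cplx) \<Rightarrow> 'a fock" where
  "elem p z = (\<lambda>n. if n = p then tens p z else 0)"

lemma gauss_apply: "gauss \<alpha> q x y f n =
    annih \<alpha> q n (cplx_of x) (cplx_of y) (f (Suc n)) + bstar (cplx_of x) (cplx_of y) f n"
  unfolding gauss_def bsub_def by (rule plus_fun_apply)

lemma gauss_linear:
  "gauss \<alpha> q x y (\<lambda>n. tscale c (f n) + g n) =
    (\<lambda>n. tscale c (gauss \<alpha> q x y f n) + gauss \<alpha> q x y g n)"
proof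
  fix n
  have add: "tscale c (h + k) = tscale c h + tscale c k" for h k :: "'a tensor"
    by (rule tensor.scale_right_distrib)
  show "gauss \<alpha> q x y (\<lambda>n. tscale c (f n) + g n) n =
      tscale c (gauss \<alpha> q x y f n) + gauss \<alpha> q x y g n"
    by (cases n) (simp_all only: gauss_apply annih_linear create_linear bstar_0 bstar_Suc add
        add_0_right tensor.scale_zero_right, simp_all only: ac_simps)
qed

lemma op_prod_gauss_linear:
  "op_prod (map (\<lambda>k. gauss \<alpha> q (x k) (y k)) ks) (\<lambda>n. tscale c (f n) + g n) =
    (\<lambda>n. tscale c (op_prod (map (\<lambda>k. gauss \<alpha> q (x k) (y k)) ks) f n) +
      op_prod (map (\<lambda>k. gauss \<alpha> q (x k) (y k)) ks) g n)"
proof (induction ks)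
  case Nil
  then show ?case
    by (simp add: op_prod_def)
next
  case (Cons k ks)
  then show ?case
    by (simp only: list.map op_prod_Cons gauss_linear)
qed

lemma op_prod_gauss_sum:
  assumes "finite I"
  shows "op_prod (map (\<lambda>k. gauss \<alpha> q (x k) (y k)) ks) (\<lambda>n. g n + (\<Sum>i\<in>I. tscale (c i) (f i n))) m z =
    op_prod (map (\<lambda>k. gauss \<alpha> q (x k) (y k)) ks) g m z +
      (\<Sum>i\<in>I. c i * op_prod (map (\<lambda>k. gauss \<alpha> q (x k) (y k)) ks) (f i) m z)"
  using assms
proof (induction rule: finite_induct)
  case (insert i I)
  let ?P = "op_prod (map (\<lambda>k. gauss \<alpha> q (x k) (y k)) ks)"
  have "(\<lambda>n. g n + (\<Sum>i\<in>insert i I. tscale (c i) (f i n))) =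
      (\<lambda>n. tscale (c i) (f i n) + (g n + (\<Sum>i\<in>I. tscale (c i) (f i n))))"
    using insert.hyps by (simp add: add.left_commute)
  then have "?P (\<lambda>n. g n + (\<Sum>i\<in>insert i I. tscale (c i) (f i n))) m z =
      c i * ?P (f i) m z + ?P (\<lambda>n. g n + (\<Sum>i\<in>I. tscale (c i) (f i n))) m z"
    by (simp only: op_prod_gauss_linear plus_fun_apply[of "tscale _ _"]) (simp only: tscale_def)
  then show ?case
    using insert by simp
qed simp

text \<open>For \<open>p = 0\<close> the truncated \<open>p - 1\<close> does no harm, since
  \<open>pm 0\<close> is empty.\<close>

lemma gauss_elem:
  "gauss \<alpha> q x y (elem p z) = (\<lambda>n.
     elem (Suc p) (z(- int (Suc p) := cplx_of x, int (Suc p) := cplx_of y)) n +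
     (\<Sum>k\<in>pm p. tscale (complex_of_real (del_weight \<alpha> q (pm p) k) *
         cinner (cplx_of x) (z (- k)) * cinner (cplx_of y) (z k))
       (elem (p - 1) (z \<circ> coset_rep (p - 1) k) n)))"
proof
  fix n
  have "bstar (cplx_of x) (cplx_of y) (elem p z) n =
      elem (Suc p) (z(- int (Suc p) := cplx_of x, int (Suc p) := cplx_of y)) n"
    by (cases n) (simp_all add: elem_def create_zero create_tens del: of_nat_Suc)
  moreover have "bsub \<alpha> q (cplx_of x) (cplx_of y) (elem p z) n =
     (\<Sum>k\<in>pm p. tscale (complex_of_real (del_weight \<alpha> q (pm p) k) *
         cinner (cplx_of x) (z (- k)) * cinner (cplx_of y) (z k))
       (elem (p - 1) (z \<circ> coset_rep (p - 1) k) n))"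
  proof (cases "p = Suc n")
    case True
    then show ?thesis
      by (simp add: bsub_def elem_def annih_tens)
  next
    case False
    have "pm p = {} \<or> n \<noteq> p - 1"
      using False by (cases p) (auto simp: pm_def)
    then show ?thesis
      using False by (auto simp: bsub_def elem_def annih_zero)
  qed
  ultimately show "gauss \<alpha> q x y (elem p z) n =
     elem (Suc p) (z(- int (Suc p) := cplx_of x, int (Suc p) := cplx_of y)) n +
     (\<Sum>k\<in>pm p. tscale (complex_of_real (del_weight \<alpha> q (pm p) k) *
         cinner (cplx_of x) (z (- k)) * cinner (cplx_of y) (z k))
       (elem (p - 1) (z \<circ> coset_rep (p - 1) k) n))"
    unfolding gauss_apply by (simp only: bsub_def add.commute)
qed

text \<open>\<open>s\<close> lists in increasing order the indices of the vectors that occur in an elementary tensor of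
  \<open>K p\<close>.\<close>

definition index_enum :: "nat \<Rightarrow> int \<Rightarrow> (int \<Rightarrow> int) \<Rightarrow> bool" where
  "index_enum p m s \<longleftrightarrow> (\<forall>i\<in>pm p. s (- i) = - s i \<and> \<bar>s i\<bar> \<le> m) \<and> strict_mono_on (pm p) s"

context
  fixes p :: nat and m :: int and s :: "int \<Rightarrow> int"
  assumes s: "index_enum p m s"
begin

lemma enum_minus: "i \<in> pm p \<Longrightarrow> s (- i) = - s i"
  and enum_abs: "i \<in> pm p \<Longrightarrow> \<bar>s i\<bar> \<le> m"
  using s by (simp_all add: index_enum_def)

lemma enum_less_iff: "i \<in> pm p \<Longrightarrow> j \<in> pm p \<Longrightarrow> s i < s j \<longleftrightarrow> i < j"
  using s by (simp add: index_enum_def strict_mono_on_less[of "pm p"])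

lemma enum_eq_iff: "i \<in> pm p \<Longrightarrow> j \<in> pm p \<Longrightarrow> s i = s j \<longleftrightarrow> i = j"
  using s by (simp add: index_enum_def strict_mono_on_eq[of "pm p"])

lemma enum_sign: "i \<in> pm p \<Longrightarrow> s i < 0 \<longleftrightarrow> i < 0" "i \<in> pm p \<Longrightarrow> s i \<noteq> 0"
proof -
  assume i: "i \<in> pm p"
  have "s i < - s i \<longleftrightarrow> i < - i" "- s i < s i \<longleftrightarrow> - i < i"
    using enum_less_iff[of i "- i"] enum_less_iff[of "- i" i] enum_minus[of i] i by simp_all
  moreover have "i \<noteq> 0"
    using i by (simp add: pm_def)
  ultimately show "s i < 0 \<longleftrightarrow> i < 0" "s i \<noteq> 0"
    by linarith+
qed

lemma enum_inj: "inj_on s (pm p)"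
  by (auto simp: inj_on_def enum_eq_iff)

lemma enum_image_Diff:
  assumes "k \<in> pm p"
  shows "s ` (pm p - {k, - k}) = s ` pm p - {s k, - s k}"
  using assms inj_on_image_set_diff[OF enum_inj, of "pm p" "{k, - k}"] by (simp add: enum_minus)

text \<open>The weight sees \<open>k\<close> only through its sign and the order of the indices, and
  \<open>s\<close> respects both.\<close>

lemma del_weight_enum:
  assumes k: "k \<in> pm p"
  shows "del_weight \<alpha> q (s ` pm p) (s k) = del_weight \<alpha> q (pm p) k"
proof -
  have "{t \<in> s ` pm p - {s k, - s k}. s k < t} = s ` {i \<in> pm p - {k, - k}. k < i}"
    unfolding enum_image_Diff[OF k, symmetric] using k by (auto simp: enum_less_iff)
  moreover have "inj_on s {i \<in> pm p - {k, - k}. k < i}"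
    using enum_inj by (rule inj_on_subset) auto
  ultimately show ?thesis
    using enum_sign(1)[OF k] by (simp add: del_weight_def card_image)
qed

text \<open>\<open>m + 1\<close> exceeds all listed indices in absolute value, so the increasing
  list has it at the outermost positions, where creation puts the new factors.\<close>

lemma enum_create:
  assumes "m \<ge> 0"
  shows "index_enum (Suc p) (m + 1) (s(- int (Suc p) := - (m + 1), int (Suc p) := m + 1))"
    (is "index_enum _ _ ?s")
    and "(s(- int (Suc p) := - (m + 1), int (Suc p) := m + 1)) ` pm (Suc p) =
      s ` pm p \<union> {m + 1, - (m + 1)}"
proof -
  let ?l = "int (Suc p)"
  have s': "?s i = s i" if "i \<in> pm p" for i
    using that by (auto simp: pm_def)
  have val: "?s ?l = m + 1" "?s (- ?l) = - (m + 1)"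
    by auto
  have range: "- ?l < i" "i < ?l" "- i \<in> pm p" "- (m + 1) < s i" "s i < m + 1" if "i \<in> pm p" for i
    using that enum_abs[OF that] by (auto simp: pm_def)
  have "?s (- i) = - ?s i \<and> \<bar>?s i\<bar> \<le> m + 1" if "i \<in> pm (Suc p)" for i
  proof -
    consider "i = - ?l" | "i = ?l" | "i \<in> pm p"
      using \<open>i \<in> pm (Suc p)\<close> unfolding pm_Suc by blast
    then show ?thesis
    proof cases
      case 3
      then show ?thesis
        using s'[of i] s'[of "- i"] enum_minus[of i] range(3-5)[of i] by simp
    qed (use assms val in auto)
  qed
  moreover have "?s i < ?s j" if "i \<in> pm (Suc p)" "j \<in> pm (Suc p)" "i < j" for i j
  proof -
    have "i = - ?l \<or> i = ?l \<or> i \<in> pm p" "j = - ?l \<or> j = ?l \<or> j \<in> pm p"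
      using that unfolding pm_Suc by blast+
    then show ?thesis
      using that(3) assms s'[of i] s'[of j] range[of i] range[of j] enum_less_iff[of i j] val
      by (elim disjE) (simp_all del: fun_upd_apply of_nat_Suc)
  qed
  ultimately show "index_enum (Suc p) (m + 1) ?s"
    by (auto simp: index_enum_def strict_mono_on_def simp del: fun_upd_apply)
  have "?s ` pm p = s ` pm p"
    using s' by (intro image_cong) auto
  then show "?s ` pm (Suc p) = s ` pm p \<union> {m + 1, - (m + 1)}"
    unfolding pm_Suc image_insert val by blast
qed

text \<open>\<open>coset_rep\<close> is increasing and odd, so the surviving indices stay listed in
  order. The bound is relaxed to \<open>m + 1\<close> to fit the next step.\<close>

lemma enum_annih:
  assumes k: "k \<in> pm p"
  shows "index_enum (p - 1) (m + 1) (s \<circ> coset_rep (p - 1) k)"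
    and "(s \<circ> coset_rep (p - 1) k) ` pm (p - 1) = s ` pm p - {s k, - s k}"
proof -
  obtain r where r: "p = Suc r"
    using k by (cases p) (auto simp: pm_def)
  have k': "k \<in> pm (Suc r)"
    using k r by simp
  let ?\<rho> = "coset_rep r k"
  have img: "?\<rho> ` pm r = pm p - {k, - k}"
    using coset_rep_image[OF k'] r by simp
  then have in_pm: "?\<rho> i \<in> pm p" if "i \<in> pm r" for i
    using that by blast
  have "s (?\<rho> (- i)) = - s (?\<rho> i) \<and> \<bar>s (?\<rho> i)\<bar> \<le> m + 1" if "i \<in> pm r" for i
    using enum_minus[OF in_pm[OF that]] enum_abs[OF in_pm[OF that]]
    by (simp add: hyperoct_minus[OF coset_rep_hyperoct[OF k']])
  moreover have "s (?\<rho> i) < s (?\<rho> j)" if "i \<in> pm r" "j \<in> pm r" "i < j" for i j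
    using that by (simp add: enum_less_iff in_pm coset_rep_less_iff)
  ultimately show "index_enum (p - 1) (m + 1) (s \<circ> coset_rep (p - 1) k)"
    by (simp add: index_enum_def strict_mono_on_def r)
  have "(s \<circ> ?\<rho>) ` pm r = s ` (pm p - {k, - k})"
    unfolding image_comp[symmetric] img ..
  then show "(s \<circ> coset_rep (p - 1) k) ` pm (p - 1) = s ` pm p - {s k, - s k}"
    unfolding enum_image_Diff[OF k] by (simp add: r)
qed

end

lemma op_prod_snoc: "op_prod (As @ [A]) f = op_prod As (A f)"
  by (induction As) (simp_all add: op_prod_def)

text \<open>Induction on the number of operators still to be applied, for all elementary tensors
  that can arise. Relabelling positions by \<open>s\<close> turns \<open>gauss_elem\<close> into the
  recursion of \<open>sum_matchings_step\<close>.\<close>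

lemma op_prod_gauss_elem:
  assumes "index_enum p m s" "0 \<le> m" "m \<le> N"
  shows "op_prod (map (\<lambda>k. gauss \<alpha> q (x (- k)) (x k)) (rev [m + 1..N]))
      (elem p (\<lambda>i. cplx_of (x (s i)))) 0 (\<lambda>_. 0) =
    complex_of_real (\<Sum>M\<in>matchings N m (s ` pm p). arc_weight \<alpha> q x M)"
  using assms
proof (induction "nat (N - m)" arbitrary: p m s)
  case 0
  then have m: "m = N"
    by simp
  \<comment> \<open>With no operator left, the level 0 component is 1 if \<open>p = 0\<close> and 0
    otherwise, and \<open>p = 0\<close> means that no index is open.\<close>
  have "pm p = {} \<longleftrightarrow> p = 0"
    by (cases p) (simp_all only: pm_Suc, simp_all add: pm_def)
  moreover have "arc_weight \<alpha> q x {} = 1"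
    by (simp add: arc_weight_def negative_arcs_def crossings_def mirror_crossings_def)
  ultimately show ?case
    by (simp add: m matchings_last op_prod_def elem_def tens_def pm_def zero_fun_apply)
next
  case (Suc d)
  note s = Suc.prems(1)
  have m: "m < N" "0 \<le> m + 1" "m + 1 \<le> N" "d = nat (N - (m + 1))"
    using Suc.hyps(2) Suc.prems by auto
  let ?S = "s ` pm p" and ?z = "\<lambda>i. cplx_of (x (s i))"
  let ?\<Phi> = "\<lambda>f. op_prod (map (\<lambda>k. gauss \<alpha> q (x (- k)) (x k)) (rev [m + 2..N])) f 0 (\<lambda>_. 0)"
  let ?s = "s(- int (Suc p) := - (m + 1), int (Suc p) := m + 1)"
  let ?W = "\<lambda>S. \<Sum>M\<in>matchings N (m + 1) S. arc_weight \<alpha> q x M"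
  note IH = Suc.hyps(1)[OF m(4) _ m(2,3)]
  have create: "?\<Phi> (elem (Suc p) (?z(- int (Suc p) := cplx_of (x (- (m + 1))),
      int (Suc p) := cplx_of (x (m + 1))))) = complex_of_real (?W (?S \<union> {m + 1, - (m + 1)}))"
  proof -
    have "?z(- int (Suc p) := cplx_of (x (- (m + 1))), int (Suc p) := cplx_of (x (m + 1))) =
        (\<lambda>i. cplx_of (x (?s i)))"
      by (simp add: fun_eq_iff del: of_nat_Suc)
    then show ?thesis
      using IH[OF enum_create(1)[OF s Suc.prems(2)]]
      unfolding enum_create(2)[OF s Suc.prems(2)] by (simp add: add.assoc del: of_nat_Suc)
  qed
  have annih: "?\<Phi> (elem (p - 1) (?z \<circ> coset_rep (p - 1) k)) = complex_of_real (?W (?S - {s k, - s k}))"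
    if k: "k \<in> pm p" for k
    using IH[OF enum_annih(1)[OF s k]] unfolding enum_annih(2)[OF s k] by (simp add: comp_def add.assoc)
  \<comment> \<open>In the reversed list \<open>m + 1\<close> stands last, so its operator acts
    first on the vector.\<close>
  have "[m + 1..N] = (m + 1) # [m + 2..N]"
    using upto_rec1[of "m + 1" N] m(3) by (simp add: add.assoc)
  then have "op_prod (map (\<lambda>k. gauss \<alpha> q (x (- k)) (x k)) (rev [m + 1..N])) (elem p ?z) 0 (\<lambda>_. 0) =
      ?\<Phi> (gauss \<alpha> q (x (- (m + 1))) (x (m + 1)) (elem p ?z))"
    by (simp add: op_prod_snoc)
  also have "\<dots> = complex_of_real (?W (?S \<union> {m + 1, - (m + 1)})) +
      (\<Sum>k\<in>pm p. complex_of_real (del_weight \<alpha> q (pm p) k) *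
         cinner (cplx_of (x (- (m + 1)))) (?z (- k)) * cinner (cplx_of (x (m + 1))) (?z k) *
         complex_of_real (?W (?S - {s k, - s k})))"
    unfolding gauss_elem op_prod_gauss_sum[OF finite_pm] create
    by (intro arg_cong2[of _ _ _ _ "(+)"] refl sum.cong) (simp only: annih)
  also have "(\<Sum>k\<in>pm p. complex_of_real (del_weight \<alpha> q (pm p) k) *
         cinner (cplx_of (x (- (m + 1)))) (?z (- k)) * cinner (cplx_of (x (m + 1))) (?z k) *
         complex_of_real (?W (?S - {s k, - s k}))) =
      complex_of_real (\<Sum>k\<in>pm p. del_weight \<alpha> q ?S (s k) * (x (s k) \<bullet> x (m + 1)) *
         (x (- s k) \<bullet> x (- (m + 1))) * ?W (?S - {s k, - s k}))"
    unfolding of_real_sum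
    by (intro sum.cong refl) (simp add: del_weight_enum[OF s] enum_minus[OF s] cinner_cplx_of inner_commute)
  also have "(\<Sum>k\<in>pm p. del_weight \<alpha> q ?S (s k) * (x (s k) \<bullet> x (m + 1)) *
         (x (- s k) \<bullet> x (- (m + 1))) * ?W (?S - {s k, - s k})) =
      (\<Sum>a\<in>?S. del_weight \<alpha> q ?S a * (x a \<bullet> x (m + 1)) * (x (- a) \<bullet> x (- (m + 1))) *
         ?W (?S - {a, - a}))"
    by (simp only: sum.reindex[OF enum_inj[OF s]] comp_def)
  also have "complex_of_real (?W (?S \<union> {m + 1, - (m + 1)})) + complex_of_real \<dots> =
      complex_of_real (\<Sum>M\<in>matchings N m ?S. arc_weight \<alpha> q x M)"
  proof -
    have "?S \<subseteq> {- m..m} - {0}"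
    proof (rule image_subsetI)
      show "s i \<in> {- m..m} - {0}" if "i \<in> pm p" for i
        using enum_abs[OF s that] enum_sign(2)[OF s that] by auto
    qed
    moreover have "\<forall>t\<in>?S. - t \<in> ?S"
      using enum_minus[OF s] by (metis (no_types, lifting) imageE imageI uminus_pm_iff)
    ultimately show ?thesis
      by (simp only: sum_matchings_step[OF Suc.prems(2) m(1)] of_real_add)
  qed
  finally show ?case .
qed

theorem theorem4p6:
  fixes x :: "int \<Rightarrow> 'a::{real_inner, polish_space}" and \<alpha> q :: real and n :: nat
  assumes "\<alpha> \<in> {-1<..<1}" and "q \<in> {-1<..<1}" and "n \<ge> 1"
  shows "vacuum_state \<alpha> q (op_prod (map (\<lambda>k. Gauss \<alpha> q (x (- k)) (x k)) (rev [1..int (2 * n)]))) =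
    complex_of_real (\<Sum>\<pi>\<in>pair_partitions_B (2 * n).
      \<alpha> ^ Nb \<pi> * q ^ Cr \<pi> * (\<Prod>(i, j)\<in>Pair_blocks \<pi>. x i \<bullet> x j))"
proof -
  have pm0: "pm 0 = {}"
    by (auto simp: pm_def)
  have "index_enum 0 0 id"
    by (simp add: index_enum_def pm0)
  \<comment> \<open>A tensor of level 0 is an empty product, so every family represents the vacuum,
    in particular one built from \<open>x\<close>.\<close>
  moreover have "tens 0 (\<lambda>_. 0) = tens 0 (\<lambda>i. cplx_of (x (id i)))"
    by (simp add: tens_def pm0)
  then have "vacuum = elem 0 (\<lambda>i. cplx_of (x (id i)))"
    by (simp only: vacuum_def elem_def)
  ultimately show ?thesis
    unfolding vacuum_state_Gauss sum_pair_partitions_B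
    using op_prod_gauss_elem[of 0 0 id "int (2 * n)" \<alpha> q x] by (simp add: pm0)
qed

end
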